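(* Let $B$ be a finite-dimensional (unital, non-zero) algebra over a field $\Bbbk$ and let $A=B\oplus D(B)$ be its trivial extension, a symmetric Frobenius algebra with respect to its canonical bilinear form. The class $\mathfrak{Div}(A)$ in $H^1(\mathrm{HH}^1(A),Z(A))$ is not trivial.
   Context: Algebras are associative and unital over $\Bbbk$. $D(B)=\mathrm{Hom}_\Bbbk(B,\Bbbk)$ is a $B$-bimodule via $(x\lambda y)(b)=\lambda(ybx)$. The trivial extension is $A=B\oplus D(B)$ with product $(x,x')(y,y')=(xy,xy'+x'y)$; its canonical bilinear form $\langle(x,x'),(y,y')\rangle=x'(y)+y'(x)$ is non-degenerate, associative and symmetric. The Nakayama divergence of a derivation $\delta:A\to A$ is the unique element $\mathrm{div}_\sigma(\delta)\in A$ such that $\langle\delta(a),b\rangle+\langle a,\delta(b)\rangle=\langle a,b\cdot\mathrm{div}_\sigma(\delta)\rangle$ for all $a,b\in A$. $Z(A)$ is the center of $A$; $\mathrm{HH}^1(A)=\mathrm{Der}(A)/\mathrm{InnDer}(A)$ is the Lie algebra of outer derivations of $A$, which acts on $Z(A)$ by evaluating derivations. As the form is symmetric, $\mathrm{div}_\sigma$ takes values in $Z(A)$, vanishes on inner derivations, and induces a Lie algebra (Chevalley–Eilenberg) $1$-cocycle $\mathrm{HH}^1(A)\to Z(A)$, whose class in the Lie algebra cohomology $H^1(\mathrm{HH}^1(A),Z(A))$ is $\mathfrak{Div}(A)$. (A $1$-cocycle $f:\mathfrak g\to M$ is a coboundary if there is $m\in M$ with $f(x)=x\cdot m$ for all $x\in\mathfrak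 g$.) *)

theory Defs
  imports "HOL-Algebra.QuotRing" "Jordan_Normal_Form.Missing_VectorSpace"
begin

subsection \<open>Algebras, linear maps and quotients\<close>

text \<open>The locale \<open>algebra\<close> of HOL-Algebra is restricted to commutative algebras.\<close>

locale assoc_algebra = vectorspace K A + ring A for K and A (structure) +
  assumes smult_mult_left:
      "\<lbrakk>c \<in> carrier K; x \<in> carrier A; y \<in> carrier A\<rbrakk> \<Longrightarrow> (c \<odot> x) \<otimes> y = c \<odot> (x \<otimes> y)"
    and smult_mult_right:
      "\<lbrakk>c \<in> carrier K; x \<in> carrier A; y \<in> carrier A\<rbrakk> \<Longrightarrow> x \<otimes> (c \<odot> y) = c \<odot> (x \<otimes> y)"

definition self_module :: "('k, 'm) ring_scheme \<Rightarrow> ('k, 'k) module"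
  where "self_module K =
    \<lparr>carrier = carrier K, mult = mult K, one = one K, zero = zero K, add = add K, smult = mult K\<rparr>"

text \<open>Linear maps are represented by functions that are \<^const>\<open>undefined\<close> outside the domain,
  so that equality of linear maps is equality of functions.  The fields \<^const>\<open>mult\<close> and
  \<^const>\<open>one\<close> carry no information; as in \<^const>\<open>direct_sum\<close> they are filled with zeros.\<close>

definition hom_space ::
    "('k, 'm) ring_scheme \<Rightarrow> ('k, 'v, 'p) module_scheme \<Rightarrow> ('k, 'w, 'q) module_scheme \<Rightarrow>
     ('k, 'v \<Rightarrow> 'w) module"
  where "hom_space K V W =
    \<lparr>carrier = LinearCombinations.module_hom K V W \<inter> extensional (carrier V),
     mult = (\<lambda>f g. \<lambda>x\<in>carrier V. \<zero>\<^bsub>W\<^esub>),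
     one = (\<lambda>x\<in>carrier V. \<zero>\<^bsub>W\<^esub>),
     zero = (\<lambda>x\<in>carrier V. \<zero>\<^bsub>W\<^esub>),
     add = (\<lambda>f g. \<lambda>x\<in>carrier V. f x \<oplus>\<^bsub>W\<^esub> g x),
     smult = (\<lambda>c f. \<lambda>x\<in>carrier V. c \<odot>\<^bsub>W\<^esub> f x)\<rparr>"

text \<open>The quotient of a vector space with a (not necessarily associative) product by a
  subspace; the product descends if the subspace is a two-sided ideal.\<close>

definition quot_space :: "('k, 'v, 'p) module_scheme \<Rightarrow> 'v set \<Rightarrow> ('k, 'v set) module"
  where "quot_space V W =
    \<lparr>carrier = a_rcosets\<^bsub>V\<^esub> W,
     mult = rcoset_mult V W,
     one = W +>\<^bsub>V\<^esub> \<one>\<^bsub>V\<^esub>,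
     zero = W,
     add = set_add V,
     smult = (\<lambda>c X. \<Union>x\<in>X. W +>\<^bsub>V\<^esub> (c \<odot>\<^bsub>V\<^esub> x))\<rparr>"


subsection \<open>First Lie algebra cohomology\<close>

text \<open>A Lie algebra \<open>L\<close> is given by a \<^typ>\<open>('k, 'l) module\<close> record whose field \<^const>\<open>mult\<close> is
  the bracket (and whose field \<^const>\<open>one\<close> is irrelevant), and an \<open>L\<close>-module by a vector space
  \<open>M\<close> and the action \<open>act :: 'l \<Rightarrow> 'm \<Rightarrow> 'm\<close>.\<close>

definition lie_cocycles1 ::
    "('k, 'a) ring_scheme \<Rightarrow> ('k, 'l, 'p) module_scheme \<Rightarrow> ('k, 'm, 'q) module_scheme \<Rightarrow>
     ('l \<Rightarrow> 'm \<Rightarrow> 'm) \<Rightarrow> ('k, 'l \<Rightarrow> 'm) module"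
  where "lie_cocycles1 K L M act = (hom_space K L M)
    \<lparr>carrier := {f \<in> carrier (hom_space K L M). \<forall>x\<in>carrier L. \<forall>y\<in>carrier L.
       f (x \<otimes>\<^bsub>L\<^esub> y) = act x (f y) \<ominus>\<^bsub>M\<^esub> act y (f x)}\<rparr>"

definition lie_coboundaries1 ::
    "('k, 'l, 'p) module_scheme \<Rightarrow> ('k, 'm, 'q) module_scheme \<Rightarrow> ('l \<Rightarrow> 'm \<Rightarrow> 'm) \<Rightarrow> ('l \<Rightarrow> 'm) set"
  where "lie_coboundaries1 L M act = {\<lambda>x\<in>carrier L. act x m | m. m \<in> carrier M}"

definition lie_H1 ::
    "('k, 'a) ring_scheme \<Rightarrow> ('k, 'l, 'p) module_scheme \<Rightarrow> ('k, 'm, 'q) module_scheme \<Rightarrow>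
     ('l \<Rightarrow> 'm \<Rightarrow> 'm) \<Rightarrow> ('k, ('l \<Rightarrow> 'm) set) module"
  where "lie_H1 K L M act = quot_space (lie_cocycles1 K L M act) (lie_coboundaries1 L M act)"

definition lie_H1_class ::
    "('k, 'a) ring_scheme \<Rightarrow> ('k, 'l, 'p) module_scheme \<Rightarrow> ('k, 'm, 'q) module_scheme \<Rightarrow>
     ('l \<Rightarrow> 'm \<Rightarrow> 'm) \<Rightarrow> ('l \<Rightarrow> 'm) \<Rightarrow> ('l \<Rightarrow> 'm) set"
  where "lie_H1_class K L M act f = lie_coboundaries1 L M act +>\<^bsub>lie_cocycles1 K L M act\<^esub> f"


subsection \<open>Outer derivations and the center\<close>

definition center_alg :: "('k, 'a, 'p) module_scheme \<Rightarrow> ('k, 'a, 'p) module_scheme"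
  where "center_alg A =
    A\<lparr>carrier := {z \<in> carrier A. \<forall>a\<in>carrier A. z \<otimes>\<^bsub>A\<^esub> a = a \<otimes>\<^bsub>A\<^esub> z}\<rparr>"

definition Der ::
    "('k, 'm) ring_scheme \<Rightarrow> ('k, 'a, 'p) module_scheme \<Rightarrow> ('k, 'a \<Rightarrow> 'a) module"
  where "Der K A = (hom_space K A A)
    \<lparr>carrier := {\<delta> \<in> carrier (hom_space K A A). \<forall>a\<in>carrier A. \<forall>b\<in>carrier A.
       \<delta> (a \<otimes>\<^bsub>A\<^esub> b) = \<delta> a \<otimes>\<^bsub>A\<^esub> b \<oplus>\<^bsub>A\<^esub> a \<otimes>\<^bsub>A\<^esub> \<delta> b},
     mult := (\<lambda>\<delta> \<epsilon>. \<lambda>a\<in>carrier A. \<delta> (\<epsilon> a) \<ominus>\<^bsub>A\<^esub> \<epsilon> (\<delta> a))\<rparr>"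

definition InnDer :: "('k, 'a, 'p) module_scheme \<Rightarrow> ('a \<Rightarrow> 'a) set"
  where "InnDer A = {\<lambda>a\<in>carrier A. c \<otimes>\<^bsub>A\<^esub> a \<ominus>\<^bsub>A\<^esub> a \<otimes>\<^bsub>A\<^esub> c | c. c \<in> carrier A}"

definition HH1 ::
    "('k, 'm) ring_scheme \<Rightarrow> ('k, 'a, 'p) module_scheme \<Rightarrow> ('k, ('a \<Rightarrow> 'a) set) module"
  where "HH1 K A = quot_space (Der K A) (InnDer A)"

text \<open>Inner derivations vanish on the center, so for a class \<open>X\<close> of derivations and a central
  \<open>z\<close> the set \<open>{\<delta> z | \<delta> \<in> X}\<close> is a singleton.\<close>

definition HH1_act :: "('a \<Rightarrow> 'a) set \<Rightarrow> 'a \<Rightarrow> 'a"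
  where "HH1_act X z = the_elem ((\<lambda>\<delta>. \<delta> z) ` X)"


subsection \<open>The divergence class of a symmetric form\<close>

definition nakayama_div ::
    "('k, 'm) ring_scheme \<Rightarrow> ('k, 'a, 'p) module_scheme \<Rightarrow> ('a \<Rightarrow> 'a \<Rightarrow> 'k) \<Rightarrow> ('a \<Rightarrow> 'a) \<Rightarrow> 'a"
  where "nakayama_div K A form \<delta> = (THE d. d \<in> carrier A \<and>
    (\<forall>a\<in>carrier A. \<forall>b\<in>carrier A.
       form (\<delta> a) b \<oplus>\<^bsub>K\<^esub> form a (\<delta> b) = form a (b \<otimes>\<^bsub>A\<^esub> d)))"

text \<open>For a symmetric form the divergence vanishes on inner derivations, so that it is constant
  on every class \<open>X\<close>.\<close>

definition div_cocycle ::
    "('k, 'm) ring_scheme \<Rightarrow> ('k, 'a, 'p) module_scheme \<Rightarrow> ('a \<Rightarrow> 'a \<Rightarrow> 'k) \<Rightarrow> ('a \<Rightarrow> 'a) set \<Rightarrow> 'a"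
  where "div_cocycle K A form =
    (\<lambda>X\<in>carrier (HH1 K A). the_elem (nakayama_div K A form ` X))"

definition Div_class ::
    "('k, 'm) ring_scheme \<Rightarrow> ('k, 'a, 'p) module_scheme \<Rightarrow> ('a \<Rightarrow> 'a \<Rightarrow> 'k) \<Rightarrow>
     (('a \<Rightarrow> 'a) set \<Rightarrow> 'a) set"
  where "Div_class K A form =
    lie_H1_class K (HH1 K A) (center_alg A) HH1_act (div_cocycle K A form)"


subsection \<open>Trivial extensions\<close>

definition dual_space ::
    "('k, 'm) ring_scheme \<Rightarrow> ('k, 'b, 'p) module_scheme \<Rightarrow> ('k, 'b \<Rightarrow> 'k) module"
  where "dual_space K B = hom_space K B (self_module K)"

definition dual_bimod :: "('k, 'b, 'p) module_scheme \<Rightarrow> 'b \<Rightarrow> ('b \<Rightarrow> 'k) \<Rightarrow> 'b \<Rightarrow> ('b \<Rightarrow> 'k)"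
  where "dual_bimod B x f y = (\<lambda>b\<in>carrier B. f (y \<otimes>\<^bsub>B\<^esub> b \<otimes>\<^bsub>B\<^esub> x))"

definition trivial_extension ::
    "('k, 'm) ring_scheme \<Rightarrow> ('k, 'b, 'p) module_scheme \<Rightarrow> ('k, 'b \<times> ('b \<Rightarrow> 'k)) module"
  where "trivial_extension K B = (direct_sum B (dual_space K B))
    \<lparr>mult := (\<lambda>(x, f) (y, g). (x \<otimes>\<^bsub>B\<^esub> y,
        dual_bimod B x g \<one>\<^bsub>B\<^esub> \<oplus>\<^bsub>dual_space K B\<^esub> dual_bimod B \<one>\<^bsub>B\<^esub> f y)),
     one := (\<one>\<^bsub>B\<^esub>, \<zero>\<^bsub>dual_space K B\<^esub>)\<rparr>"

definition canonical_form ::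
    "('k, 'm) ring_scheme \<Rightarrow> 'b \<times> ('b \<Rightarrow> 'k) \<Rightarrow> 'b \<times> ('b \<Rightarrow> 'k) \<Rightarrow> 'k"
  where "canonical_form K = (\<lambda>(x, f) (y, g). f y \<oplus>\<^bsub>K\<^esub> g x)"

end

theory Submission
  imports Defs
begin

text \<open>For a symmetric form, \<open>\<langle>\<delta> a, b\<rangle> + \<langle>a, \<delta> b\<rangle> = \<langle>\<delta> (a b), 1\<rangle>\<close> and \<open>\<langle>a, b d\<rangle> = \<langle>a b, d\<rangle>\<close>, so the
  divergence of \<open>\<delta>\<close> is the element \<open>d\<close> representing the functional \<open>c \<mapsto> \<langle>\<delta> c, 1\<rangle>\<close>.  Centrality, vanishing
  on inner derivations and the cocycle identity all follow from this description.  For the trivial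
  extension, representability of functionals amounts to reflexivity of the finite-dimensional
  space \<open>B\<close>.  The class is non-trivial because of the Euler derivation \<open>E (x, f) = (0, f)\<close>: its
  divergence is the unit \<open>(1, 0)\<close>, whereas a coboundary would send it to some \<open>E m\<close>, an element
  with zero first component.\<close>

subsection \<open>Spaces of linear maps and reflexivity\<close>

lemma carrier_hom_space:
  "f \<in> carrier (hom_space K V W) \<longleftrightarrow> f \<in> extensional (carrier V) \<and> f \<in> carrier V \<rightarrow> carrier W \<and>
    (\<forall>x\<in>carrier V. \<forall>y\<in>carrier V. f (x \<oplus>\<^bsub>V\<^esub> y) = f x \<oplus>\<^bsub>W\<^esub> f y) \<and>
    (\<forall>c\<in>carrier K. \<forall>x\<in>carrier V. f (c \<odot>\<^bsub>V\<^esub> x) = c \<odot>\<^bsub>W\<^esub> f x)"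
  by (auto simp: hom_space_def module_hom_def)

lemma hom_space_sel [simp]:
  "\<zero>\<^bsub>hom_space K V W\<^esub> = (\<lambda>x\<in>carrier V. \<zero>\<^bsub>W\<^esub>)"
  "f \<oplus>\<^bsub>hom_space K V W\<^esub> g = (\<lambda>x\<in>carrier V. f x \<oplus>\<^bsub>W\<^esub> g x)"
  "c \<odot>\<^bsub>hom_space K V W\<^esub> f = (\<lambda>x\<in>carrier V. c \<odot>\<^bsub>W\<^esub> f x)"
  by (simp_all add: hom_space_def)

lemma self_module_sel [simp]:
  "carrier (self_module K) = carrier K"
  "\<zero>\<^bsub>self_module K\<^esub> = \<zero>\<^bsub>K\<^esub>"
  "x \<oplus>\<^bsub>self_module K\<^esub> y = x \<oplus>\<^bsub>K\<^esub> y"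
  "c \<odot>\<^bsub>self_module K\<^esub> x = c \<otimes>\<^bsub>K\<^esub> x"
  by (simp_all add: self_module_def)

lemma (in cring) self_module_is_module: "module R (self_module R)"
proof (rule moduleI)
  show "abelian_group (self_module R)"
    by (rule abelian_groupI) (auto simp: a_ac intro: exI[of _ "\<ominus> _"] l_neg)
qed (auto simp: l_distr r_distr m_assoc is_cring)

lemma hom_space_is_module:
  assumes "module K V" "module K W"
  shows "module K (hom_space K V W)"
proof -
  interpret V: module K V by fact
  interpret W: module K W by fact
  show ?thesis
  proof (rule moduleI)
    show "abelian_group (hom_space K V W)"
    proof (rule abelian_groupI)
      fix f assume f: "f \<in> carrier (hom_space K V W)"
      let ?g = "\<lambda>x\<in>carrier V. \<ominus>\<^bsub>W\<^esub> f x"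
      have "?g \<in> carrier (hom_space K V W)"
        using f by (auto simp: carrier_hom_space Pi_iff W.minus_add W.smult_r_minus W.a_comm)
      moreover have "?g \<oplus>\<^bsub>hom_space K V W\<^esub> f = \<zero>\<^bsub>hom_space K V W\<^esub>"
        using f by (auto simp: carrier_hom_space Pi_iff W.l_neg intro!: restrict_ext)
      ultimately show "\<exists>g\<in>carrier (hom_space K V W).
          g \<oplus>\<^bsub>hom_space K V W\<^esub> f = \<zero>\<^bsub>hom_space K V W\<^esub>"
        by blast
    qed (auto simp: carrier_hom_space Pi_iff W.a_ac W.smult_r_distr extensional_def
          intro!: restrict_ext ext)
  qed (auto simp: carrier_hom_space Pi_iff W.a_ac W.smult_r_distr W.smult_l_distr W.smult_assoc1[symmetric]
        V.m_comm V.is_cring extensional_def intro!: restrict_ext ext)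
qed

section \<open>Finite sums, dual bases and reflexivity of finite-dimensional spaces\<close>

lemma (in mod_hom) hom_finsum:
  assumes "finite S" "g \<in> S \<rightarrow> carrier M"
  shows "f (\<Oplus>\<^bsub>M\<^esub>s\<in>S. g s) = (\<Oplus>\<^bsub>N\<^esub>s\<in>S. f (g s))"
  using assms by (induction S rule: finite_induct) (auto simp: Pi_iff)

lemma (in vectorspace) dual_space_is_module: "module K (dual_space K V)"
  unfolding dual_space_def
  by (rule hom_space_is_module[OF module_axioms self_module_is_module])

text \<open>Here \<open>S\<close> is a basis and \<open>c s\<close> the coordinate functional at
  \<open>s\<close>. Coordinates are linear because the sum, or a scalar multiple, of coefficient
  families is again a family of coefficients for the corresponding vector, and expansions in a basis
  are unique.\<close>

lemma (in vectorspace) dual_basis_exists: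
  assumes "fin_dim"
  obtains S c where "finite S" "S \<subseteq> carrier V" "\<And>s. s \<in> S \<Longrightarrow> c s \<in> carrier (dual_space K V)"
    "\<And>x. x \<in> carrier V \<Longrightarrow> lincomb (\<lambda>s. c s x) S = x"
proof -
  obtain S where S: "finite S" "basis S"
    using finite_basis_exists[OF assms] by blast
  have SV: "S \<subseteq> carrier V"
    using S(2) by (simp add: basis_def)
  have uniq: "\<exists>!a. a \<in> S \<rightarrow>\<^sub>E carrier K \<and> lincomb a S = x" if "x \<in> carrier V" for x
    using basis_criterion[OF S(1) SV] S(2) that by blast
  define a where "a x = (THE a. a \<in> S \<rightarrow>\<^sub>E carrier K \<and> lincomb a S = x)" for x
  have a: "a x \<in> S \<rightarrow>\<^sub>E carrier K" "lincomb (a x) S = x" if "x \<in> carrier V" for x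
    using theI'[OF uniq[OF that]] by (simp_all add: a_def)
  \<comment> \<open>Uniqueness of expansions is available only for coefficient functions that are
    \<open>undefined\<close> outside \<open>S\<close>; restricting \<open>b\<close> to
    \<open>S\<close> brings any coefficient function into that form.\<close>
  have a_eq: "b s = a x s" if "x \<in> carrier V" "b \<in> S \<rightarrow> carrier K" "lincomb b S = x" "s \<in> S" for b x s
  proof -
    have "lincomb (restrict b S) S = x"
      using that(3) lincomb_restrict[OF SV that(2), of "restrict b S"] by simp
    moreover have "restrict b S \<in> S \<rightarrow>\<^sub>E carrier K"
      using that(2) by auto
    ultimately have "restrict b S = a x"
      using uniq[OF that(1)] a[OF that(1)] by blast
    then show ?thesis
      using that(4) by (metis restrict_apply')
  qed
  have aS: "a x s \<in> carrier K" if "x \<in> carrier V" "s \<in> S" for x s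
    using a(1)[OF that(1)] that(2) by blast
  define c where "c s = (\<lambda>x\<in>carrier V. a x s)" for s
  have "c s \<in> carrier (dual_space K V)" if s: "s \<in> S" for s
  proof -
    have "a (x \<oplus>\<^bsub>V\<^esub> y) s = a x s \<oplus>\<^bsub>K\<^esub> a y s" if "x \<in> carrier V" "y \<in> carrier V" for x y
    proof -
      have "lincomb (\<lambda>s. a x s \<oplus>\<^bsub>K\<^esub> a y s) S = x \<oplus>\<^bsub>V\<^esub> y"
        using lincomb_sum[OF S(1) SV, of "a x" "a y"] a that aS by (simp add: Pi_iff)
      then show ?thesis
        using a_eq[of "x \<oplus>\<^bsub>V\<^esub> y" "\<lambda>s. a x s \<oplus>\<^bsub>K\<^esub> a y s" s] that aS s by (simp add: Pi_iff)
    qed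
    moreover have "a (k \<odot>\<^bsub>V\<^esub> x) s = k \<otimes>\<^bsub>K\<^esub> a x s" if "k \<in> carrier K" "x \<in> carrier V" for k x
    proof -
      have "lincomb (\<lambda>s. k \<otimes>\<^bsub>K\<^esub> a x s) S = k \<odot>\<^bsub>V\<^esub> x"
        using lincomb_smult[OF SV, of "a x" k] a that aS by (simp add: Pi_iff)
      then show ?thesis
        using a_eq[of "k \<odot>\<^bsub>V\<^esub> x" "\<lambda>s. k \<otimes>\<^bsub>K\<^esub> a x s" s] that aS s by (simp add: Pi_iff)
    qed
    ultimately show ?thesis
      using aS s by (auto simp: dual_space_def carrier_hom_space c_def)
  qed
  moreover have "lincomb (\<lambda>s. c s x) S = x" if "x \<in> carrier V" for x
    using a(2)[OF that] that by (simp add: c_def)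
  ultimately show ?thesis
    using that S(1) SV by blast
qed

text \<open>All coordinates of \<open>x\<close> and \<open>y\<close> agree, and a vector is
  recovered from its coordinates. For the trivial extension this yields uniqueness of the first
  component of a representing element.\<close>

lemma (in vectorspace) dual_separates_points:
  assumes "fin_dim" "x \<in> carrier V" "y \<in> carrier V"
    and "\<And>f. f \<in> carrier (dual_space K V) \<Longrightarrow> f x = f y"
  shows "x = y"
proof -
  obtain S c where S: "finite S" "S \<subseteq> carrier V" "\<And>s. s \<in> S \<Longrightarrow> c s \<in> carrier (dual_space K V)"
    "\<And>x. x \<in> carrier V \<Longrightarrow> lincomb (\<lambda>s. c s x) S = x"
    using dual_basis_exists[OF assms(1)] by blast
  have "restrict (\<lambda>s. c s x) S = restrict (\<lambda>s. c s y) S"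
    using S(3) assms(4) by (auto intro: restrict_ext)
  moreover have "c s x \<in> carrier K" if "s \<in> S" for s
    using S(3)[OF that] assms(2) by (auto simp: dual_space_def carrier_hom_space)
  then have "(\<lambda>s. c s x) \<in> S \<rightarrow> carrier K"
    by blast
  ultimately have "lincomb (\<lambda>s. c s x) S = lincomb (\<lambda>s. c s y) S"
    by (intro lincomb_restrict[OF S(2)])
  then show ?thesis
    using S(4) assms(2,3) by simp
qed

text \<open>Take \<open>x\<close> to be the sum of the \<open>\<phi> (c s) s\<close>. Expanding
  \<open>f\<close> as the sum of the \<open>f s\<close> times \<open>c s\<close> and applying \<phi>
  gives the same value as applying \<open>f\<close> to \<open>x\<close>.\<close>

lemma (in vectorspace) double_dual_surj:
  assumes "fin_dim"
    and \<phi>: "\<phi> \<in> LinearCombinations.module_hom K (dual_space K V) (self_module K)"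
  obtains x where "x \<in> carrier V" "\<And>f. f \<in> carrier (dual_space K V) \<Longrightarrow> \<phi> f = f x"
proof -
  obtain S c where S: "finite S" "S \<subseteq> carrier V" "\<And>s. s \<in> S \<Longrightarrow> c s \<in> carrier (dual_space K V)"
    "\<And>x. x \<in> carrier V \<Longrightarrow> lincomb (\<lambda>s. c s x) S = x"
    using dual_basis_exists[OF assms(1)] by blast
  interpret D: module K "dual_space K V" by (rule dual_space_is_module)
  interpret K: module K "self_module K" by (rule self_module_is_module)
  interpret \<phi>: mod_hom K "dual_space K V" "self_module K" \<phi>
    by unfold_locales (rule \<phi>)
  define x where "x = lincomb (\<lambda>s. \<phi> (c s)) S"
  have \<phi>c: "\<phi> (c s) \<in> carrier K" if "s \<in> S" for s
    using \<phi>.f_im[OF S(3)[OF that]] by simp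
  have x: "x \<in> carrier V"
    unfolding x_def using S(2) \<phi>c by auto
  have "\<phi> f = f x" if f: "f \<in> carrier (dual_space K V)" for f
  proof -
    interpret f: mod_hom K V "self_module K" f
      using f by unfold_locales (simp add: dual_space_def hom_space_def)
    have fs: "f s \<in> carrier K" if "s \<in> S" for s
      using f.f_im[of s] S(2) that by auto
    have cx: "c s y \<in> carrier K" if "s \<in> S" "y \<in> carrier V" for s y
      using S(3)[OF that(1)] that(2) by (auto simp: dual_space_def carrier_hom_space)
    \<comment> \<open>The expansion of \<open>f\<close> in the coordinate functionals. It is
      compared with \<open>f\<close> at each point \<open>y\<close>, and extensionality then gives
      equality of functions.\<close>
    let ?g = "\<Oplus>\<^bsub>dual_space K V\<^esub>s\<in>S. f s \<odot>\<^bsub>dual_space K V\<^esub> c s"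
    have g: "?g \<in> carrier (dual_space K V)"
      using fs S(3) by (intro D.finsum_closed) auto
    have "f y = ?g y" if y: "y \<in> carrier V" for y
    proof -
      \<comment> \<open>Evaluation at \<open>y\<close> is linear on the dual space, so the value of
        the sum \<open>?g\<close> at \<open>y\<close> is the sum of the values.\<close>
      interpret ev: mod_hom K "dual_space K V" "self_module K" "\<lambda>h. h y"
        by unfold_locales (use y in \<open>auto simp: module_hom_def dual_space_def carrier_hom_space\<close>)
      have "f y = f (lincomb (\<lambda>s. c s y) S)"
        using S(4) y by simp
      also have "\<dots> = (\<Oplus>\<^bsub>self_module K\<^esub>s\<in>S. f (c s y \<odot>\<^bsub>V\<^esub> s))"
        unfolding lincomb_def using S(2) cx y by (intro f.hom_finsum[OF S(1)]) auto
      also have "\<dots> = (\<Oplus>\<^bsub>self_module K\<^esub>s\<in>S. (f s \<odot>\<^bsub>dual_space K V\<^esub> c s) y)"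
        using S(2) cx y fs by (intro K.finsum_cong') (auto simp: f.f_smult subsetD dual_space_def m_comm)
      also have "\<dots> = ?g y"
        using fs S(3) by (intro ev.hom_finsum[OF S(1), symmetric]) auto
      finally show ?thesis .
    qed
    then have "f = ?g"
      using f g by (intro extensionalityI[of f "carrier V" ?g])
        (auto simp: dual_space_def carrier_hom_space)
    then have "\<phi> f = \<phi> ?g"
      by simp
    also have "\<dots> = (\<Oplus>\<^bsub>self_module K\<^esub>s\<in>S. \<phi> (f s \<odot>\<^bsub>dual_space K V\<^esub> c s))"
      using fs S(3) by (intro \<phi>.hom_finsum[OF S(1)]) auto
    also have "\<dots> = (\<Oplus>\<^bsub>self_module K\<^esub>s\<in>S. f (\<phi> (c s) \<odot>\<^bsub>V\<^esub> s))"
      using S(2,3) \<phi>c fs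
      by (intro K.finsum_cong') (auto simp: f.f_smult \<phi>.f_smult subsetD m_comm)
    also have "\<dots> = f x"
      unfolding x_def lincomb_def using S(2) \<phi>c by (intro f.hom_finsum[OF S(1), symmetric]) auto
    finally show ?thesis .
  qed
  then show ?thesis
    using that x by blast
qed

subsection \<open>Quotients of modules\<close>

text \<open>The module axioms do not see \<open>mult\<close> and \<open>one\<close> of the module
  record. Hence a record whose product was overwritten, by the bracket of derivations or by the
  product of the trivial extension, remains a module.\<close>

lemma module_cong:
  fixes M N :: "('a, 'b, 'c) module_scheme"
  assumes "module R M" "carrier N = carrier M" "zero N = zero M" "add N = add M" "smult N = smult M"
  shows "module R N"
proof -
  have "add_monoid N = add_monoid M"
    using assms by simp
  then show ?thesis
    using assms unfolding module_def abelian_group_def abelian_monoid_def abelian_group_axioms_def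
      module_axioms_def by simp
qed

text \<open>Closure under negation comes from \<open>(-1) v = - v\<close>. This makes the coset
  calculus of abelian groups applicable to submodules.\<close>

lemma (in submodule) is_abelian_subgroup: "abelian_subgroup N M"
proof -
  interpret M: module R M by (rule module)
  have neg: "\<ominus> v \<in> N" if "v \<in> N" for v
  proof -
    have "\<ominus> v = (\<ominus>\<^bsub>R\<^esub> \<one>\<^bsub>R\<^esub>) \<odot> v"
      using subset that by (simp add: M.smult_minus_1 subsetD)
    then show ?thesis
      using that by simp
  qed
  have "subgroup N (add_monoid M)"
    using subset neg by (intro M.add.subgroupI) (auto intro: zero_closed simp: a_inv_def[symmetric])
  then show ?thesis
    by (intro abelian_subgroupI3 additive_subgroupI M.abelian_group_axioms)
qed

lemma quot_space_sel [simp]: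
  "\<zero>\<^bsub>quot_space V W\<^esub> = W"
  "X \<oplus>\<^bsub>quot_space V W\<^esub> Y = X <+>\<^bsub>V\<^esub> Y"
  "X \<otimes>\<^bsub>quot_space V W\<^esub> Y = rcoset_mult V W X Y"
  "c \<odot>\<^bsub>quot_space V W\<^esub> X = (\<Union>x\<in>X. W +>\<^bsub>V\<^esub> (c \<odot>\<^bsub>V\<^esub> x))"
  by (simp_all add: quot_space_def)

lemma carrier_quot_space: "carrier (quot_space V W) = (\<lambda>x. W +>\<^bsub>V\<^esub> x) ` carrier V"
  by (auto simp: quot_space_def A_RCOSETS_def')

context submodule
begin

lemma coset_eqI: "\<lbrakk>x \<in> carrier M; y \<in> N +> x\<rbrakk> \<Longrightarrow> N +> y = N +> x"
  using is_abelian_subgroup module unfolding module_def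
  by (metis abelian_group.a_repr_independence abelian_subgroup.axioms(1) additive_subgroup.a_subgroup
      abelian_subgroup_def)

lemma self_in_coset: "x \<in> carrier M \<Longrightarrow> x \<in> N +> x"
  using is_abelian_subgroup by (rule abelian_subgroup.a_rcos_self)

lemma coset_add:
  "\<lbrakk>x \<in> carrier M; y \<in> carrier M\<rbrakk> \<Longrightarrow> (N +> x) <+> (N +> y) = N +> (x \<oplus> y)"
  using is_abelian_subgroup by (rule abelian_subgroup.a_rcos_sum)

text \<open>If \<open>y\<close> and \<open>x\<close> differ by an element of \<open>N\<close>, so do
  \<open>c y\<close> and \<open>c x\<close>. The union that defines scalar multiplication in
  \<open>quot_space\<close> is therefore a single coset.\<close>

lemma coset_smult:
  assumes "c \<in> carrier R" "x \<in> carrier M"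
  shows "(\<Union>y\<in>N +> x. N +> (c \<odot> y)) = N +> (c \<odot> x)"
proof -
  interpret M: module R M by (rule module)
  have "N +> (c \<odot> y) = N +> (c \<odot> x)" if y: "y \<in> N +> x" for y
  proof -
    obtain n where "n \<in> N" "y = n \<oplus> x"
      using y by (auto simp: a_r_coset_def')
    then have "c \<odot> y \<in> N +> (c \<odot> x)"
      using assms subset by (auto simp: a_r_coset_def' M.smult_r_distr subsetD)
    then show ?thesis
      using assms by (intro coset_eqI) auto
  qed
  then show ?thesis
    using self_in_coset[OF assms(2)] by blast
qed

end

subsection \<open>Derivations modulo inner derivations\<close>

lemma carrier_Der:
  "\<delta> \<in> carrier (Der K A) \<longleftrightarrow> \<delta> \<in> carrier (hom_space K A A) \<and> (\<forall>a\<in>carrier A. \<forall>b\<in>carrier A.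
     \<delta> (a \<otimes>\<^bsub>A\<^esub> b) = \<delta> a \<otimes>\<^bsub>A\<^esub> b \<oplus>\<^bsub>A\<^esub> a \<otimes>\<^bsub>A\<^esub> \<delta> b)"
  by (simp add: Der_def)

lemma Der_sel [simp]:
  "\<zero>\<^bsub>Der K A\<^esub> = (\<lambda>x\<in>carrier A. \<zero>\<^bsub>A\<^esub>)"
  "\<delta> \<oplus>\<^bsub>Der K A\<^esub> \<epsilon> = (\<lambda>a\<in>carrier A. \<delta> a \<oplus>\<^bsub>A\<^esub> \<epsilon> a)"
  "c \<odot>\<^bsub>Der K A\<^esub> \<delta> = (\<lambda>a\<in>carrier A. c \<odot>\<^bsub>A\<^esub> \<delta> a)"
  "\<delta> \<otimes>\<^bsub>Der K A\<^esub> \<epsilon> = (\<lambda>a\<in>carrier A. \<delta> (\<epsilon> a) \<ominus>\<^bsub>A\<^esub> \<epsilon> (\<delta> a))"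
  using hom_space_sel by (simp_all add: Der_def hom_space_def)

context assoc_algebra
begin

lemma Der_closed [simp, intro]:
  "\<lbrakk>\<delta> \<in> carrier (Der K A); a \<in> carrier A\<rbrakk> \<Longrightarrow> \<delta> a \<in> carrier A"
  by (auto simp: carrier_Der carrier_hom_space)

lemma Der_add:
  "\<lbrakk>\<delta> \<in> carrier (Der K A); a \<in> carrier A; b \<in> carrier A\<rbrakk> \<Longrightarrow> \<delta> (a \<oplus> b) = \<delta> a \<oplus> \<delta> b"
  by (auto simp: carrier_Der carrier_hom_space)

lemma Der_smult:
  "\<lbrakk>\<delta> \<in> carrier (Der K A); c \<in> carrier K; a \<in> carrier A\<rbrakk> \<Longrightarrow> \<delta> (c \<odot> a) = c \<odot> \<delta> a"
  by (auto simp: carrier_Der carrier_hom_space)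

lemma Der_mult:
  "\<lbrakk>\<delta> \<in> carrier (Der K A); a \<in> carrier A; b \<in> carrier A\<rbrakk> \<Longrightarrow> \<delta> (a \<otimes> b) = \<delta> a \<otimes> b \<oplus> a \<otimes> \<delta> b"
  by (auto simp: carrier_Der)

lemma Der_zero:
  assumes "\<delta> \<in> carrier (Der K A)" shows "\<delta> \<zero> = \<zero>"
proof -
  have "\<delta> \<zero> \<oplus> \<delta> \<zero> = \<delta> \<zero>"
    using Der_add[OF assms, of \<zero> \<zero>] by simp
  then show ?thesis
    using assms by (metis Der_closed add.l_cancel_one' zero_closed)
qed

lemma Der_neg:
  assumes "\<delta> \<in> carrier (Der K A)" "a \<in> carrier A" shows "\<delta> (\<ominus> a) = \<ominus> \<delta> a"
proof -
  have "\<delta> (\<ominus> a) \<oplus> \<delta> a = \<zero>"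
    using Der_add[OF assms(1), of "\<ominus> a" a] assms Der_zero[OF assms(1)] by (simp add: l_neg)
  then show ?thesis
    using assms by (metis Der_closed a_inv_closed minus_equality)
qed

lemma Der_minus:
  "\<lbrakk>\<delta> \<in> carrier (Der K A); a \<in> carrier A; b \<in> carrier A\<rbrakk> \<Longrightarrow> \<delta> (a \<ominus> b) = \<delta> a \<ominus> \<delta> b"
  by (simp add: a_minus_def Der_add Der_neg)

lemma DerI:
  assumes "\<And>a. a \<in> carrier A \<Longrightarrow> \<delta> a \<in> carrier A"
    and "\<And>a b. \<lbrakk>a \<in> carrier A; b \<in> carrier A\<rbrakk> \<Longrightarrow> \<delta> (a \<oplus> b) = \<delta> a \<oplus> \<delta> b"
    and "\<And>c a. \<lbrakk>c \<in> carrier K; a \<in> carrier A\<rbrakk> \<Longrightarrow> \<delta> (c \<odot> a) = c \<odot> \<delta> a"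
    and "\<And>a b. \<lbrakk>a \<in> carrier A; b \<in> carrier A\<rbrakk> \<Longrightarrow> \<delta> (a \<otimes> b) = \<delta> a \<otimes> b \<oplus> a \<otimes> \<delta> b"
  shows "(\<lambda>a\<in>carrier A. \<delta> a) \<in> carrier (Der K A)"
  using assms by (auto simp: carrier_Der carrier_hom_space)

lemma smult_minus: "\<lbrakk>c \<in> carrier K; x \<in> carrier A; y \<in> carrier A\<rbrakk> \<Longrightarrow> c \<odot> (x \<ominus> y) = c \<odot> x \<ominus> c \<odot> y"
  by (simp add: a_minus_def smult_r_distr smult_r_minus)

text \<open>The Leibniz rule is a linear condition, which cuts a submodule out of the linear
  endomorphisms; exchanging the product of that record for the bracket is harmless by
  \<open>module_cong\<close>.\<close>

lemma Der_is_module: "module K (Der K A)"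
proof -
  have "submodule K (carrier (Der K A)) (hom_space K A A)"
  proof (rule submodule.intro)
    show "module K (hom_space K A A)"
      by (rule hom_space_is_module[OF module_axioms module_axioms])
  next
    show "carrier (Der K A) \<subseteq> carrier (hom_space K A A)"
      by (auto simp: carrier_Der)
  next
    fix \<delta> \<epsilon> assume "\<delta> \<in> carrier (Der K A)" "\<epsilon> \<in> carrier (Der K A)"
    then show "\<delta> \<oplus>\<^bsub>hom_space K A A\<^esub> \<epsilon> \<in> carrier (Der K A)"
      by (auto intro!: DerI simp: Der_add Der_smult Der_mult l_distr r_distr a_ac smult_r_distr)
  next
    show "\<zero>\<^bsub>hom_space K A A\<^esub> \<in> carrier (Der K A)"
      by (auto intro!: DerI)
  next
    fix c \<delta> assume "c \<in> carrier K" "\<delta> \<in> carrier (Der K A)"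
    then show "c \<odot>\<^bsub>hom_space K A A\<^esub> \<delta> \<in> carrier (Der K A)"
      by (auto intro!: DerI simp: Der_add Der_smult Der_mult smult_mult_left smult_mult_right
          smult_r_distr smult_assoc1[symmetric] m_comm)
  qed
  from LinearCombinations.module.submodule_is_module[OF hom_space_is_module[OF module_axioms module_axioms] this]
  show ?thesis
    by (rule module_cong) (auto simp: Der_def hom_space_def)
qed

section \<open>The Lie bracket of derivations\<close>

lemma bracket_closed:
  assumes "\<delta> \<in> carrier (Der K A)" "\<epsilon> \<in> carrier (Der K A)"
  shows "\<delta> \<otimes>\<^bsub>Der K A\<^esub> \<epsilon> \<in> carrier (Der K A)"
  unfolding Der_sel
proof (rule DerI)
  fix a b assume ab: "a \<in> carrier A" "b \<in> carrier A"
  \<comment> \<open>Here \<open>p\<close>, \<open>q\<close>, \<open>r\<close>, \<open>s\<close>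
    stand for \<open>\<epsilon> a\<close>, \<open>\<delta> b\<close>, \<open>\<delta> a\<close>,
    \<open>\<epsilon> b\<close>. The cross terms \<open>p q\<close> and \<open>r s\<close> occur in
    both second-order expansions and cancel.\<close>
  have "x \<otimes> b \<oplus> p \<otimes> q \<oplus> (r \<otimes> s \<oplus> a \<otimes> y) \<ominus> (z \<otimes> b \<oplus> r \<otimes> s \<oplus> (p \<otimes> q \<oplus> a \<otimes> w)) =
      (x \<ominus> z) \<otimes> b \<oplus> a \<otimes> (y \<ominus> w)"
    if "x \<in> carrier A" "y \<in> carrier A" "z \<in> carrier A" "w \<in> carrier A"
      "p \<in> carrier A" "q \<in> carrier A" "r \<in> carrier A" "s \<in> carrier A" for x y z w p q r s
    using that ab by algebra
  then show "\<delta> (\<epsilon> (a \<otimes> b)) \<ominus> \<epsilon> (\<delta> (a \<otimes> b)) =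
      (\<delta> (\<epsilon> a) \<ominus> \<epsilon> (\<delta> a)) \<otimes> b \<oplus> a \<otimes> (\<delta> (\<epsilon> b) \<ominus> \<epsilon> (\<delta> b))"
    using assms ab by (simp add: Der_mult Der_add)
next
  fix a b assume "a \<in> carrier A" "b \<in> carrier A"
  then show "\<delta> (\<epsilon> (a \<oplus> b)) \<ominus> \<epsilon> (\<delta> (a \<oplus> b)) = (\<delta> (\<epsilon> a) \<ominus> \<epsilon> (\<delta> a)) \<oplus> (\<delta> (\<epsilon> b) \<ominus> \<epsilon> (\<delta> b))"
    using assms by (simp add: Der_add a_minus_def minus_add a_ac)
qed (use assms in \<open>simp_all add: Der_smult smult_minus\<close>)

section \<open>Inner derivations as a Lie ideal\<close>

definition ad
  where "ad c = (\<lambda>a\<in>carrier A. c \<otimes> a \<ominus> a \<otimes> c)"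

lemma InnDer_eq: "InnDer A = ad ` carrier A"
  by (auto simp: InnDer_def ad_def)

lemma ad_closed: "c \<in> carrier A \<Longrightarrow> ad c \<in> carrier (Der K A)"
  unfolding ad_def
proof (rule DerI)
  fix a b assume "c \<in> carrier A" "a \<in> carrier A" "b \<in> carrier A"
  then show "c \<otimes> (a \<oplus> b) \<ominus> (a \<oplus> b) \<otimes> c = c \<otimes> a \<ominus> a \<otimes> c \<oplus> (c \<otimes> b \<ominus> b \<otimes> c)"
    by algebra
next
  fix a b assume "c \<in> carrier A" "a \<in> carrier A" "b \<in> carrier A"
  then show "c \<otimes> (a \<otimes> b) \<ominus> a \<otimes> b \<otimes> c = (c \<otimes> a \<ominus> a \<otimes> c) \<otimes> b \<oplus> a \<otimes> (c \<otimes> b \<ominus> b \<otimes> c)"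
    by algebra
qed (simp_all add: smult_mult_left smult_mult_right smult_minus)

text \<open>The inner derivations are the image of the linear map
  \<open>c \<mapsto> ad c\<close>.\<close>

lemma InnDer_submodule: "submodule K (InnDer A) (Der K A)"
proof (rule submodule.intro)
  show "module K (Der K A)"
    by (rule Der_is_module)
next
  show "InnDer A \<subseteq> carrier (Der K A)"
    by (auto simp: InnDer_eq ad_closed)
next
  fix v w assume "v \<in> InnDer A" "w \<in> InnDer A"
  then obtain c d where cd: "c \<in> carrier A" "d \<in> carrier A" "v = ad c" "w = ad d"
    by (auto simp: InnDer_eq)
  have "v \<oplus>\<^bsub>Der K A\<^esub> w = ad (c \<oplus> d)"
    unfolding cd(3,4) ad_def Der_sel
  proof (rule restrict_ext)
    fix a assume "a \<in> carrier A"
    then show "(\<lambda>a\<in>carrier A. c \<otimes> a \<ominus> a \<otimes> c) a \<oplus> (\<lambda>a\<in>carrier A. d \<otimes> a \<ominus> a \<otimes> d) a =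
        (c \<oplus> d) \<otimes> a \<ominus> a \<otimes> (c \<oplus> d)"
      using cd(1,2) by simp algebra
  qed
  then show "v \<oplus>\<^bsub>Der K A\<^esub> w \<in> InnDer A"
    using cd(1,2) by (simp add: InnDer_eq)
next
  have "\<zero>\<^bsub>Der K A\<^esub> = ad \<zero>"
    by (auto simp: ad_def a_minus_def intro!: restrict_ext)
  then show "\<zero>\<^bsub>Der K A\<^esub> \<in> InnDer A"
    by (simp add: InnDer_eq)
next
  fix k v assume k: "k \<in> carrier K" and "v \<in> InnDer A"
  then obtain c where c: "c \<in> carrier A" "v = ad c"
    by (auto simp: InnDer_eq)
  have "k \<odot>\<^bsub>Der K A\<^esub> v = ad (k \<odot> c)"
    using c k by (auto simp: ad_def smult_mult_left smult_mult_right smult_minus intro!: restrict_ext)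
  then show "k \<odot>\<^bsub>Der K A\<^esub> v \<in> InnDer A"
    using c k by (simp add: InnDer_eq)
qed

text \<open>By the Leibniz rule the terms containing \<open>\<delta> a\<close> cancel, which leaves
  the commutator of \<open>\<delta> d\<close> with \<open>a\<close>. The identity
  \<open>[\<delta>, ad d] = ad (\<delta> d)\<close> is what makes the inner derivations a Lie
  ideal.\<close>

lemma bracket_ad:
  assumes "\<delta> \<in> carrier (Der K A)" "d \<in> carrier A" "a \<in> carrier A"
  shows "\<delta> (ad d a) \<ominus> ad d (\<delta> a) = ad (\<delta> d) a"
proof -
  have "p \<otimes> a \<oplus> d \<otimes> x \<ominus> (x \<otimes> d \<oplus> a \<otimes> p) \<ominus> (d \<otimes> x \<ominus> x \<otimes> d) = p \<otimes> a \<ominus> a \<otimes> p"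
    if "p \<in> carrier A" "x \<in> carrier A" for p x
  proof -
    have "t \<oplus> u \<ominus> (v \<oplus> w) \<ominus> (u \<ominus> v) = t \<ominus> w"
      if "t \<in> carrier A" "u \<in> carrier A" "v \<in> carrier A" "w \<in> carrier A" for t u v w
      using that by algebra
    then show ?thesis
      using that assms(2,3) by simp
  qed
  then show ?thesis
    using assms by (simp add: ad_def Der_minus Der_mult)
qed

text \<open>The bracket splits into \<open>[ad c + \<delta>, ad d] - [\<epsilon>, ad c] +
  [\<delta>, \<epsilon>]\<close>. The first two brackets are inner by \<open>bracket_ad\<close>,
  with elements \<open>ad c d + \<delta> d\<close> and \<open>\<epsilon> c\<close>.\<close>

lemma bracket_mod_InnDer:
  assumes "\<delta> \<in> carrier (Der K A)" "\<epsilon> \<in> carrier (Der K A)" "c \<in> carrier A" "d \<in> carrier A"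
  shows "(ad c \<oplus>\<^bsub>Der K A\<^esub> \<delta>) \<otimes>\<^bsub>Der K A\<^esub> (ad d \<oplus>\<^bsub>Der K A\<^esub> \<epsilon>) =
    ad (ad c d \<oplus> \<delta> d \<ominus> \<epsilon> c) \<oplus>\<^bsub>Der K A\<^esub> \<delta> \<otimes>\<^bsub>Der K A\<^esub> \<epsilon>"
proof -
  have X: "ad c \<oplus>\<^bsub>Der K A\<^esub> \<delta> \<in> carrier (Der K A)"
    using Der_is_module ad_closed[OF assms(3)] assms(1)
    by (meson abelian_group_def abelian_monoid.a_closed module_def)
  show ?thesis
    unfolding Der_sel(2,4)
  proof (rule restrict_ext)
    fix a assume a: "a \<in> carrier A"
    note closed = Der_closed[OF assms(1)] Der_closed[OF assms(2)] Der_closed[OF ad_closed]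
    have "ad (e \<ominus> f) a = ad e a \<ominus> ad f a" if "e \<in> carrier A" "f \<in> carrier A" for e f
      using that a by (simp add: ad_def) algebra
    then have "ad (ad c d \<oplus> \<delta> d \<ominus> \<epsilon> c) a = ad (ad c d \<oplus> \<delta> d) a \<ominus> ad (\<epsilon> c) a"
      using assms closed by simp
    also have "\<dots> = (ad c (ad d a) \<oplus> \<delta> (ad d a) \<ominus> ad d (ad c a \<oplus> \<delta> a)) \<ominus> (\<epsilon> (ad c a) \<ominus> ad c (\<epsilon> a))"
      using bracket_ad[OF X assms(4) a] bracket_ad[OF assms(2,3) a] a assms closed by simp
    finally have *: "ad (ad c d \<oplus> \<delta> d \<ominus> \<epsilon> c) a = \<dots>" .
    \<comment> \<open>A regrouping in the additive group: \<open>q\<close> stands for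
      \<open>ad c (\<epsilon> a)\<close>, which moves from the expanded product into the bracket of
      \<epsilon> with \<open>ad c\<close>.\<close>
    have "p \<oplus> q \<oplus> (r \<oplus> s) \<ominus> (t \<oplus> (u \<oplus> v)) = (p \<oplus> r \<ominus> t \<ominus> (u \<ominus> q)) \<oplus> (s \<ominus> v)"
      if "p \<in> carrier A" "q \<in> carrier A" "r \<in> carrier A" "s \<in> carrier A"
        "t \<in> carrier A" "u \<in> carrier A" "v \<in> carrier A" for p q r s t u v
      using that by algebra
    then show "(\<lambda>a\<in>carrier A. ad c a \<oplus> \<delta> a) ((\<lambda>a\<in>carrier A. ad d a \<oplus> \<epsilon> a) a) \<ominus>
        (\<lambda>a\<in>carrier A. ad d a \<oplus> \<epsilon> a) ((\<lambda>a\<in>carrier A. ad c a \<oplus> \<delta> a) a) =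
        ad (ad c d \<oplus> \<delta> d \<ominus> \<epsilon> c) a \<oplus> (\<lambda>a\<in>carrier A. \<delta> (\<epsilon> a) \<ominus> \<epsilon> (\<delta> a)) a"
      unfolding * using assms a closed by (simp add: Der_add ad_closed)
  qed
qed

text \<open>Changing representatives alters the bracket only by an inner derivation, so the union in
  \<open>rcoset_mult\<close> collapses to one coset and \<open>HH1\<close> carries a well-defined
  bracket.\<close>

lemma rcoset_mult_InnDer:
  assumes "\<delta> \<in> carrier (Der K A)" "\<epsilon> \<in> carrier (Der K A)"
  shows "rcoset_mult (Der K A) (InnDer A) (InnDer A +>\<^bsub>Der K A\<^esub> \<delta>) (InnDer A +>\<^bsub>Der K A\<^esub> \<epsilon>) =
    InnDer A +>\<^bsub>Der K A\<^esub> (\<delta> \<otimes>\<^bsub>Der K A\<^esub> \<epsilon>)"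
proof -
  interpret I: submodule K "InnDer A" "Der K A" by (rule InnDer_submodule)
  have "InnDer A +>\<^bsub>Der K A\<^esub> (x \<otimes>\<^bsub>Der K A\<^esub> y) = InnDer A +>\<^bsub>Der K A\<^esub> (\<delta> \<otimes>\<^bsub>Der K A\<^esub> \<epsilon>)"
    if xy: "x \<in> InnDer A +>\<^bsub>Der K A\<^esub> \<delta>" "y \<in> InnDer A +>\<^bsub>Der K A\<^esub> \<epsilon>" for x y
  proof -
    obtain c d where cd: "c \<in> carrier A" "d \<in> carrier A"
      "x = ad c \<oplus>\<^bsub>Der K A\<^esub> \<delta>" "y = ad d \<oplus>\<^bsub>Der K A\<^esub> \<epsilon>"
      using xy by (auto simp: a_r_coset_def' InnDer_eq simp del: Der_sel)
    have "x \<otimes>\<^bsub>Der K A\<^esub> y = ad (ad c d \<oplus> \<delta> d \<ominus> \<epsilon> c) \<oplus>\<^bsub>Der K A\<^esub> \<delta> \<otimes>\<^bsub>Der K A\<^esub> \<epsilon>"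
      unfolding cd by (rule bracket_mod_InnDer[OF assms cd(1,2)])
    moreover have "ad (ad c d \<oplus> \<delta> d \<ominus> \<epsilon> c) \<in> InnDer A"
      using cd(1,2) assms by (simp add: InnDer_eq ad_closed)
    ultimately show ?thesis
      by (intro I.coset_eqI bracket_closed assms) (auto simp: a_r_coset_def' simp del: Der_sel)
  qed
  then show ?thesis
    using I.self_in_coset[OF assms(1)] I.self_in_coset[OF assms(2)]
    unfolding rcoset_mult_def by blast
qed

end

section \<open>The center and the action of outer derivations on it\<close>

lemma carrier_center:
  "z \<in> carrier (center_alg A) \<longleftrightarrow> z \<in> carrier A \<and> (\<forall>a\<in>carrier A. z \<otimes>\<^bsub>A\<^esub> a = a \<otimes>\<^bsub>A\<^esub> z)"
  by (simp add: center_alg_def)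

lemma center_sel [simp]:
  "\<zero>\<^bsub>center_alg A\<^esub> = \<zero>\<^bsub>A\<^esub>"
  "x \<oplus>\<^bsub>center_alg A\<^esub> y = x \<oplus>\<^bsub>A\<^esub> y"
  "c \<odot>\<^bsub>center_alg A\<^esub> x = c \<odot>\<^bsub>A\<^esub> x"
  by (simp_all add: center_alg_def)

context assoc_algebra
begin

lemma center_is_module: "module K (center_alg A)"
proof -
  have "submodule K (carrier (center_alg A)) A"
    by (rule submodule.intro)
      (auto simp: carrier_center module_axioms l_distr r_distr smult_mult_left smult_mult_right)
  from LinearCombinations.module.submodule_is_module[OF module_axioms this]
  show ?thesis
    by (simp add: center_alg_def)
qed

text \<open>Negation in a record is an inverse sought within its carrier, so the differences in
  \<open>center_alg A\<close> and in \<open>A\<close> have to be identified by hand. The cocycle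
  condition is stated with the former, the computations use the latter.\<close>

lemma center_minus:
  assumes "x \<in> carrier (center_alg A)" "y \<in> carrier (center_alg A)"
  shows "x \<ominus>\<^bsub>center_alg A\<^esub> y = x \<ominus> y"
proof -
  interpret Z: module K "center_alg A" by (rule center_is_module)
  have "\<ominus>\<^bsub>center_alg A\<^esub> y = \<ominus> y"
  proof (rule Z.minus_equality)
    show "\<ominus> y \<in> carrier (center_alg A)"
      using assms(2) by (simp add: carrier_center l_minus r_minus)
  qed (use assms(2) in \<open>simp_all add: carrier_center l_neg\<close>)
  then show ?thesis
    by (simp add: a_minus_def)
qed

text \<open>Apply \<delta> to \<open>z a = a z\<close>. Since \<open>z\<close> also commutes with
  \<open>\<delta> a\<close>, what remains is that \<open>\<delta> z\<close> commutes with
  \<open>a\<close>.\<close>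

lemma Der_center:
  assumes "\<delta> \<in> carrier (Der K A)" "z \<in> carrier (center_alg A)"
  shows "\<delta> z \<in> carrier (center_alg A)"
proof -
  have z: "z \<in> carrier A"
    using assms(2) by (simp add: carrier_center)
  have "\<delta> z \<otimes> a = a \<otimes> \<delta> z" if a: "a \<in> carrier A" for a
  proof -
    have "\<delta> z \<otimes> a \<oplus> z \<otimes> \<delta> a = \<delta> a \<otimes> z \<oplus> a \<otimes> \<delta> z"
      using assms a z Der_mult[OF assms(1) z a] Der_mult[OF assms(1) a z] by (simp add: carrier_center)
    moreover have "z \<otimes> \<delta> a = \<delta> a \<otimes> z"
      using assms a by (simp add: carrier_center)
    ultimately have "\<delta> a \<otimes> z \<oplus> \<delta> z \<otimes> a = \<delta> a \<otimes> z \<oplus> a \<otimes> \<delta> z"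
      using assms(1) a z by (simp add: a_comm)
    then show ?thesis
      using assms(1) a z by simp
  qed
  then show ?thesis
    using assms(1) z by (simp add: carrier_center)
qed

lemma HH1_act_coset:
  assumes "\<delta> \<in> carrier (Der K A)" "z \<in> carrier (center_alg A)"
  shows "HH1_act (InnDer A +>\<^bsub>Der K A\<^esub> \<delta>) z = \<delta> z"
proof -
  interpret I: submodule K "InnDer A" "Der K A" by (rule InnDer_submodule)
  have "\<epsilon> z = \<delta> z" if "\<epsilon> \<in> InnDer A +>\<^bsub>Der K A\<^esub> \<delta>" for \<epsilon>
    using that assms by (auto simp: a_r_coset_def' InnDer_eq ad_def carrier_center r_neg a_minus_def)
  then have "(\<lambda>\<epsilon>. \<epsilon> z) ` (InnDer A +>\<^bsub>Der K A\<^esub> \<delta>) = {\<delta> z}"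
    using I.self_in_coset[OF assms(1)] by blast
  then show ?thesis
    by (simp add: HH1_act_def)
qed

end

subsection \<open>Symmetric algebras and the divergence cocycle\<close>

text \<open>\<open>form_perfect\<close> asks that \<open>d \<mapsto> form _ d\<close> be a bijection
  onto the linear functionals, which in infinite dimension is more than non-degeneracy. Its
  existence half yields divergences, its uniqueness half yields equations between elements.
  Linearity is assumed in the first argument; symmetry transfers it to the second.\<close>

locale symmetric_algebra = assoc_algebra K A for K and A (structure) +
  fixes form
  assumes form_hom: "b \<in> carrier A \<Longrightarrow> (\<lambda>a. form a b) \<in> LinearCombinations.module_hom K A (self_module K)"
    and form_sym: "\<lbrakk>a \<in> carrier A; b \<in> carrier A\<rbrakk> \<Longrightarrow> form a b = form b a"
    and form_assoc: "\<lbrakk>a \<in> carrier A; b \<in> carrier A; c \<in> carrier A\<rbrakk> \<Longrightarrow> form (a \<otimes> b) c = form a (b \<otimes> c)"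
    and form_perfect: "\<phi> \<in> LinearCombinations.module_hom K A (self_module K) \<Longrightarrow>
      \<exists>!d. d \<in> carrier A \<and> (\<forall>a\<in>carrier A. \<phi> a = form a d)"
begin

section \<open>Bilinearity and the trace property of the form\<close>

lemma form_closed [simp, intro]: "\<lbrakk>a \<in> carrier A; b \<in> carrier A\<rbrakk> \<Longrightarrow> form a b \<in> carrier K"
  using form_hom[of b] by (auto simp: module_hom_def)

lemma form_add_left:
  "\<lbrakk>a \<in> carrier A; b \<in> carrier A; c \<in> carrier A\<rbrakk> \<Longrightarrow> form (a \<oplus> b) c = form a c \<oplus>\<^bsub>K\<^esub> form b c"
  using form_hom[of c] by (auto simp: module_hom_def)

lemma form_smult_left:
  "\<lbrakk>k \<in> carrier K; a \<in> carrier A; b \<in> carrier A\<rbrakk> \<Longrightarrow> form (k \<odot> a) b = k \<otimes>\<^bsub>K\<^esub> form a b"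
  using form_hom[of b] by (auto simp: module_hom_def)

lemma form_add_right:
  "\<lbrakk>a \<in> carrier A; b \<in> carrier A; c \<in> carrier A\<rbrakk> \<Longrightarrow> form c (a \<oplus> b) = form c a \<oplus>\<^bsub>K\<^esub> form c b"
  using form_add_left[of a b c] by (simp add: form_sym)

lemma form_smult_right:
  "\<lbrakk>k \<in> carrier K; a \<in> carrier A; b \<in> carrier A\<rbrakk> \<Longrightarrow> form b (k \<odot> a) = k \<otimes>\<^bsub>K\<^esub> form b a"
  using form_smult_left[of k a b] by (simp add: form_sym)

lemma form_minus_left:
  assumes "a \<in> carrier A" "b \<in> carrier A" "c \<in> carrier A"
  shows "form (a \<ominus> b) c = form a c \<ominus>\<^bsub>K\<^esub> form b c"
proof -
  have "form (a \<ominus> b) c \<oplus>\<^bsub>K\<^esub> form b c = form (a \<ominus> b \<oplus> b) c"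
    using assms by (simp add: form_add_left)
  also have "a \<ominus> b \<oplus> b = a"
    using assms by algebra
  finally have "form a c \<ominus>\<^bsub>K\<^esub> form b c = form (a \<ominus> b) c \<oplus>\<^bsub>K\<^esub> form b c \<ominus>\<^bsub>K\<^esub> form b c"
    by simp
  also have "\<dots> = form (a \<ominus> b) c"
    using assms by (simp add: a_minus_def R.a_assoc R.r_neg)
  finally show ?thesis ..
qed

lemma form_minus_right:
  "\<lbrakk>a \<in> carrier A; b \<in> carrier A; c \<in> carrier A\<rbrakk> \<Longrightarrow> form c (a \<ominus> b) = form c a \<ominus>\<^bsub>K\<^esub> form c b"
  using form_minus_left[of a b c] by (simp add: form_sym)

lemma form_eqI:
  assumes "d \<in> carrier A" "e \<in> carrier A" "\<And>a. a \<in> carrier A \<Longrightarrow> form a d = form a e"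
  shows "d = e"
  using form_perfect[OF form_hom[OF assms(1)]] assms by blast

text \<open>By associativity both sides reduce to \<open>form a b\<close> and
  \<open>form b a\<close>. Thus \<open>form _ \<one>\<close> is a trace: it kills
  commutators.\<close>

lemma form_mult_comm: "\<lbrakk>a \<in> carrier A; b \<in> carrier A\<rbrakk> \<Longrightarrow> form (a \<otimes> b) \<one> = form (b \<otimes> a) \<one>"
  using form_sym[of a b] by (simp add: form_assoc)

section \<open>The Nakayama divergence of a derivation\<close>

lemma div_condition_iff:
  assumes "\<delta> \<in> carrier (Der K A)" "d \<in> carrier A"
  shows "(\<forall>a\<in>carrier A. \<forall>b\<in>carrier A. form (\<delta> a) b \<oplus>\<^bsub>K\<^esub> form a (\<delta> b) = form a (b \<otimes> d)) \<longleftrightarrow>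
    (\<forall>c\<in>carrier A. form (\<delta> c) \<one> = form c d)"
proof -
  have "form (\<delta> a) b \<oplus>\<^bsub>K\<^esub> form a (\<delta> b) = form (\<delta> (a \<otimes> b)) \<one>" "form a (b \<otimes> d) = form (a \<otimes> b) d"
    if "a \<in> carrier A" "b \<in> carrier A" for a b
    using assms that by (simp_all add: Der_mult form_add_left form_assoc)
  \<comment> \<open>Both sides of the divergence condition depend on the product
    \<open>a \<otimes> b\<close> alone, and with \<open>b = \<one>\<close> every \<open>c\<close> is
    such a product.\<close>
  then show ?thesis
    by (metis m_closed one_closed r_one)
qed

text \<open>After \<open>div_condition_iff\<close> the description operator ranges over the elements
  that represent the functional \<open>c \<mapsto> form (\<delta> c) \<one>\<close>; perfectness
  provides exactly one.\<close>

lemma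
  assumes "\<delta> \<in> carrier (Der K A)"
  shows nakayama_div_closed: "nakayama_div K A form \<delta> \<in> carrier A"
    and form_nakayama_div: "\<And>c. c \<in> carrier A \<Longrightarrow> form c (nakayama_div K A form \<delta>) = form (\<delta> c) \<one>"
    and nakayama_div_eqI: "\<And>d. \<lbrakk>d \<in> carrier A; \<And>c. c \<in> carrier A \<Longrightarrow> form (\<delta> c) \<one> = form c d\<rbrakk> \<Longrightarrow>
      nakayama_div K A form \<delta> = d"
proof -
  have "(\<lambda>c. form (\<delta> c) \<one>) \<in> LinearCombinations.module_hom K A (self_module K)"
    using assms by (auto simp: module_hom_def Der_add Der_smult form_add_left form_smult_left)
  from form_perfect[OF this] have ex1: "\<exists>!d. d \<in> carrier A \<and> (\<forall>c\<in>carrier A. form (\<delta> c) \<one> = form c d)" .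
  have eq: "nakayama_div K A form \<delta> = (THE d. d \<in> carrier A \<and> (\<forall>c\<in>carrier A. form (\<delta> c) \<one> = form c d))"
    unfolding nakayama_div_def by (intro arg_cong[of _ _ The] ext conj_cong refl div_condition_iff[OF assms])
  have *: "nakayama_div K A form \<delta> \<in> carrier A \<and>
      (\<forall>c\<in>carrier A. form (\<delta> c) \<one> = form c (nakayama_div K A form \<delta>))"
    unfolding eq by (rule theI'[OF ex1])
  show "nakayama_div K A form \<delta> \<in> carrier A"
    using * by blast
  show "form c (nakayama_div K A form \<delta>) = form (\<delta> c) \<one>" if "c \<in> carrier A" for c
    using * that by simp
  show "nakayama_div K A form \<delta> = d"
    if "d \<in> carrier A" "\<And>c. c \<in> carrier A \<Longrightarrow> form (\<delta> c) \<one> = form c d" for d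
    using ex1 * that by blast
qed

text \<open>The divergence condition solved for its first term. It exhibits the adjoint of \<delta>
  for the form as \<open>b \<mapsto> b d - \<delta> b\<close>, where \<open>d\<close> is the
  divergence.\<close>

lemma form_Der_left:
  assumes "\<delta> \<in> carrier (Der K A)" "a \<in> carrier A" "b \<in> carrier A"
  shows "form (\<delta> a) b = form a (b \<otimes> nakayama_div K A form \<delta>) \<ominus>\<^bsub>K\<^esub> form a (\<delta> b)"
proof -
  have "form (\<delta> a) b \<oplus>\<^bsub>K\<^esub> form a (\<delta> b) = form a (b \<otimes> nakayama_div K A form \<delta>)"
    using div_condition_iff[OF assms(1) nakayama_div_closed[OF assms(1)]] form_nakayama_div[OF assms(1)] assms
    by simp
  then have "form a (b \<otimes> nakayama_div K A form \<delta>) \<ominus>\<^bsub>K\<^esub> form a (\<delta> b) =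
      form (\<delta> a) b \<oplus>\<^bsub>K\<^esub> form a (\<delta> b) \<ominus>\<^bsub>K\<^esub> form a (\<delta> b)"
    by simp
  also have "\<dots> = form (\<delta> a) b"
    using assms by (simp add: a_minus_def R.a_assoc R.r_neg)
  finally show ?thesis ..
qed

text \<open>Pairing \<open>a\<close> with \<open>d b\<close> and with \<open>b d\<close> gives the
  traces of \<open>\<delta> (b a)\<close> and \<open>\<delta> (a b)\<close>. These agree because
  \<delta> maps commutators to sums of commutators.\<close>

lemma nakayama_div_central:
  assumes "\<delta> \<in> carrier (Der K A)"
  shows "nakayama_div K A form \<delta> \<in> carrier (center_alg A)"
proof -
  let ?d = "nakayama_div K A form \<delta>"
  have d: "?d \<in> carrier A"
    by (rule nakayama_div_closed[OF assms])
  have "?d \<otimes> b = b \<otimes> ?d" if b: "b \<in> carrier A" for b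
  proof (rule form_eqI)
    fix a assume a: "a \<in> carrier A"
    have "form a (?d \<otimes> b) = form (b \<otimes> a) ?d"
      using a b d form_sym[of a "?d \<otimes> b"] form_sym[of ?d "b \<otimes> a"] by (simp add: form_assoc)
    also have "\<dots> = form (\<delta> b \<otimes> a \<oplus> b \<otimes> \<delta> a) \<one>"
      using a b assms by (simp add: form_nakayama_div Der_mult)
    \<comment> \<open>Each of the two products is turned around under the trace, which converts the
      Leibniz expansion of \<open>\<delta> (b a)\<close> into that of
      \<open>\<delta> (a b)\<close>.\<close>
    also have "\<dots> = form (\<delta> a \<otimes> b \<oplus> a \<otimes> \<delta> b) \<one>"
      using a b assms form_mult_comm[of "\<delta> b" a] form_mult_comm[of b "\<delta> a"]
      by (simp add: form_add_left R.a_comm)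
    also have "\<dots> = form (a \<otimes> b) ?d"
      using a b assms by (simp add: form_nakayama_div Der_mult)
    also have "\<dots> = form a (b \<otimes> ?d)"
      using a b d by (simp add: form_assoc)
    finally show "form a (?d \<otimes> b) = form a (b \<otimes> ?d)" .
  qed (use b d in simp_all)
  then show ?thesis
    using d by (simp add: carrier_center)
qed

text \<open>The values of \<open>ad c\<close> are commutators, which the trace kills; the
  represented functional is therefore unchanged.\<close>

lemma nakayama_div_mod_InnDer:
  assumes "\<delta> \<in> carrier (Der K A)" "\<epsilon> \<in> InnDer A +>\<^bsub>Der K A\<^esub> \<delta>"
  shows "nakayama_div K A form \<epsilon> = nakayama_div K A form \<delta>"
proof -
  interpret D: module K "Der K A" by (rule Der_is_module)
  obtain c where c: "c \<in> carrier A" and \<epsilon>: "\<epsilon> = ad c \<oplus>\<^bsub>Der K A\<^esub> \<delta>"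
    using assms(2) by (auto simp: a_r_coset_def' InnDer_eq simp del: Der_sel)
  have "\<epsilon> \<in> carrier (Der K A)"
    unfolding \<epsilon> using ad_closed[OF c] assms(1) by (rule D.a_closed)
  then show ?thesis
  proof (rule nakayama_div_eqI)
    show "nakayama_div K A form \<delta> \<in> carrier A"
      by (rule nakayama_div_closed[OF assms(1)])
  next
    fix a assume a: "a \<in> carrier A"
    then have "form (\<epsilon> a) \<one> = form (c \<otimes> a) \<one> \<ominus>\<^bsub>K\<^esub> form (a \<otimes> c) \<one> \<oplus>\<^bsub>K\<^esub> form (\<delta> a) \<one>"
      using c assms(1) by (simp add: \<epsilon> ad_def form_add_left form_minus_left)
    also have "\<dots> = form a (nakayama_div K A form \<delta>)"
      using a c assms(1) form_mult_comm[OF a c] by (simp add: form_nakayama_div a_minus_def R.r_neg)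
    finally show "form (\<epsilon> a) \<one> = form a (nakayama_div K A form \<delta>)" .
  qed
qed

lemma div_cocycle_coset:
  assumes "\<delta> \<in> carrier (Der K A)"
  shows "div_cocycle K A form (InnDer A +>\<^bsub>Der K A\<^esub> \<delta>) = nakayama_div K A form \<delta>"
proof -
  interpret I: submodule K "InnDer A" "Der K A" by (rule InnDer_submodule)
  have "nakayama_div K A form ` (InnDer A +>\<^bsub>Der K A\<^esub> \<delta>) = {nakayama_div K A form \<delta>}"
    using nakayama_div_mod_InnDer[OF assms] I.self_in_coset[OF assms] by blast
  then show ?thesis
    using assms by (simp add: div_cocycle_def HH1_def carrier_quot_space)
qed

lemma nakayama_div_add:
  assumes "\<delta> \<in> carrier (Der K A)" "\<epsilon> \<in> carrier (Der K A)"
  shows "nakayama_div K A form (\<delta> \<oplus>\<^bsub>Der K A\<^esub> \<epsilon>) = nakayama_div K A form \<delta> \<oplus> nakayama_div K A form \<epsilon>"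
proof -
  interpret D: module K "Der K A" by (rule Der_is_module)
  show ?thesis
    using D.a_closed[OF assms]
    by (rule nakayama_div_eqI)
      (use assms in \<open>simp_all add: nakayama_div_closed form_add_left form_add_right form_nakayama_div\<close>)
qed

lemma nakayama_div_smult:
  assumes "k \<in> carrier K" "\<delta> \<in> carrier (Der K A)"
  shows "nakayama_div K A form (k \<odot>\<^bsub>Der K A\<^esub> \<delta>) = k \<odot> nakayama_div K A form \<delta>"
proof -
  interpret D: module K "Der K A" by (rule Der_is_module)
  show ?thesis
    using D.smult_closed[OF assms]
    by (rule nakayama_div_eqI)
      (use assms in \<open>simp_all add: nakayama_div_closed form_smult_left form_smult_right form_nakayama_div\<close>)
qed

text \<open>The trace of the bracket at \<open>c\<close> is
  \<open>form (\<epsilon> c) d - form (\<delta> c) e\<close>, with \<open>d\<close> and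
  \<open>e\<close> the two divergences. Moving both derivations to the right by
  \<open>form_Der_left\<close> produces \<open>form c (d e)\<close> and \<open>form c (e d)\<close>,
  which cancel by centrality.\<close>

lemma nakayama_div_bracket:
  assumes "\<delta> \<in> carrier (Der K A)" "\<epsilon> \<in> carrier (Der K A)"
  shows "nakayama_div K A form (\<delta> \<otimes>\<^bsub>Der K A\<^esub> \<epsilon>) =
    \<delta> (nakayama_div K A form \<epsilon>) \<ominus> \<epsilon> (nakayama_div K A form \<delta>)"
  using bracket_closed[OF assms]
proof (rule nakayama_div_eqI)
  let ?d = "nakayama_div K A form \<delta>" and ?e = "nakayama_div K A form \<epsilon>"
  have d: "?d \<in> carrier A" and e: "?e \<in> carrier A" and de: "?d \<otimes> ?e = ?e \<otimes> ?d"
    using nakayama_div_central[OF assms(1)] nakayama_div_central[OF assms(2)]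
    unfolding carrier_center by blast+
  show "\<delta> ?e \<ominus> \<epsilon> ?d \<in> carrier A"
    using d e assms by simp
  fix c assume c: "c \<in> carrier A"
  have K: "x \<ominus>\<^bsub>K\<^esub> y \<ominus>\<^bsub>K\<^esub> (x \<ominus>\<^bsub>K\<^esub> z) = z \<ominus>\<^bsub>K\<^esub> y"
    if "x \<in> carrier K" "y \<in> carrier K" "z \<in> carrier K" for x y z
    using that by (simp add: a_minus_def R.minus_add R.a_ac R.r_neg2)
  have "form ((\<delta> \<otimes>\<^bsub>Der K A\<^esub> \<epsilon>) c) \<one> = form (\<epsilon> c) ?d \<ominus>\<^bsub>K\<^esub> form (\<delta> c) ?e"
    using c assms by (simp add: form_minus_left form_nakayama_div)
  also have "\<dots> = form c (?d \<otimes> ?e) \<ominus>\<^bsub>K\<^esub> form c (\<epsilon> ?d) \<ominus>\<^bsub>K\<^esub> (form c (?e \<otimes> ?d) \<ominus>\<^bsub>K\<^esub> form c (\<delta> ?e))"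
    using form_Der_left[OF assms(2) c d] form_Der_left[OF assms(1) c e] by simp
  also have "\<dots> = form c (\<delta> ?e \<ominus> \<epsilon> ?d)"
    using c d e assms K by (simp add: form_minus_right de)
  finally show "form ((\<delta> \<otimes>\<^bsub>Der K A\<^esub> \<epsilon>) c) \<one> = form c (\<delta> ?e \<ominus> \<epsilon> ?d)" .
qed

section \<open>The divergence class in Lie algebra cohomology\<close>

lemma carrier_HH1: "carrier (HH1 K A) = (\<lambda>\<delta>. InnDer A +>\<^bsub>Der K A\<^esub> \<delta>) ` carrier (Der K A)"
  by (simp add: HH1_def carrier_quot_space)

text \<open>Every element of \<open>HH1\<close> is the coset of a derivation, and sum, scalar
  multiple, bracket and action are computed on representatives. The conditions thus reduce to
  additivity, homogeneity and the bracket rule of the divergence.\<close>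

theorem div_cocycle_is_cocycle:
  "div_cocycle K A form \<in> carrier (lie_cocycles1 K (HH1 K A) (center_alg A) HH1_act)"
proof -
  interpret I: submodule K "InnDer A" "Der K A" by (rule InnDer_submodule)
  interpret D: module K "Der K A" by (rule Der_is_module)
  let ?f = "div_cocycle K A form"
  let ?cl = "\<lambda>\<delta>. InnDer A +>\<^bsub>Der K A\<^esub> \<delta>"
  have ext: "?f \<in> extensional (carrier (HH1 K A))"
    by (simp add: div_cocycle_def)
  have add: "?f (?cl \<delta> \<oplus>\<^bsub>HH1 K A\<^esub> ?cl \<epsilon>) = ?f (?cl \<delta>) \<oplus> ?f (?cl \<epsilon>)"
    if "\<delta> \<in> carrier (Der K A)" "\<epsilon> \<in> carrier (Der K A)" for \<delta> \<epsilon>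
    using that D.a_closed[OF that] by (simp add: HH1_def I.coset_add div_cocycle_coset nakayama_div_add del: Der_sel)
  have smult: "?f (k \<odot>\<^bsub>HH1 K A\<^esub> ?cl \<delta>) = k \<odot> ?f (?cl \<delta>)"
    if "k \<in> carrier K" "\<delta> \<in> carrier (Der K A)" for k \<delta>
    using that D.smult_closed[OF that]
    by (simp add: HH1_def I.coset_smult div_cocycle_coset nakayama_div_smult del: Der_sel)
  have bracket: "?f (?cl \<delta> \<otimes>\<^bsub>HH1 K A\<^esub> ?cl \<epsilon>) =
      HH1_act (?cl \<delta>) (?f (?cl \<epsilon>)) \<ominus>\<^bsub>center_alg A\<^esub> HH1_act (?cl \<epsilon>) (?f (?cl \<delta>))"
    if \<delta>\<epsilon>: "\<delta> \<in> carrier (Der K A)" "\<epsilon> \<in> carrier (Der K A)" for \<delta> \<epsilon>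
  proof -
    have "?f (?cl \<delta> \<otimes>\<^bsub>HH1 K A\<^esub> ?cl \<epsilon>) =
        \<delta> (nakayama_div K A form \<epsilon>) \<ominus> \<epsilon> (nakayama_div K A form \<delta>)"
      using \<delta>\<epsilon> bracket_closed[OF \<delta>\<epsilon>]
      by (simp add: HH1_def rcoset_mult_InnDer div_cocycle_coset nakayama_div_bracket del: Der_sel)
    also have "\<dots> = \<delta> (nakayama_div K A form \<epsilon>) \<ominus>\<^bsub>center_alg A\<^esub> \<epsilon> (nakayama_div K A form \<delta>)"
      using \<delta>\<epsilon> by (simp add: center_minus Der_center nakayama_div_central)
    finally show ?thesis
      using \<delta>\<epsilon> by (simp add: HH1_act_coset div_cocycle_coset nakayama_div_central)
  qed
  have "?f \<in> carrier (hom_space K (HH1 K A) (center_alg A))"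
    unfolding carrier_hom_space using ext add smult
    by (auto simp: carrier_HH1 div_cocycle_coset nakayama_div_central)
  then show ?thesis
    using bracket by (auto simp: lie_cocycles1_def carrier_HH1)
qed

theorem Div_class_in_H1:
  "Div_class K A form \<in> carrier (lie_H1 K (HH1 K A) (center_alg A) HH1_act)"
  using div_cocycle_is_cocycle
  by (simp add: Div_class_def lie_H1_class_def lie_H1_def carrier_quot_space)

text \<open>The zero of \<open>lie_H1\<close> is the set of coboundaries itself. The cocycle lies in
  its own class, hence is a coboundary, and \<open>z\<close> is the central element that defines
  it.\<close>

theorem Div_class_eq_zeroD:
  assumes "Div_class K A form = \<zero>\<^bsub>lie_H1 K (HH1 K A) (center_alg A) HH1_act\<^esub>"
  obtains z where "z \<in> carrier (center_alg A)"
    "\<And>\<delta>. \<delta> \<in> carrier (Der K A) \<Longrightarrow> nakayama_div K A form \<delta> = \<delta> z"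
proof -
  let ?f = "div_cocycle K A form"
  let ?B = "lie_coboundaries1 (HH1 K A) (center_alg A) HH1_act"
  let ?Z = "lie_cocycles1 K (HH1 K A) (center_alg A) HH1_act"
  interpret Z: module K "center_alg A" by (rule center_is_module)
  \<comment> \<open>The coboundary of \<zero> is the zero cochain; adding it to \<open>?f\<close>
    places \<open>?f\<close> in its own coset.\<close>
  let ?o = "\<lambda>X\<in>carrier (HH1 K A). HH1_act X \<zero>"
  have o: "?o \<in> ?B"
    using Z.zero_closed by (force simp: lie_coboundaries1_def)
  have "?o \<oplus>\<^bsub>?Z\<^esub> ?f = ?f"
  proof -
    have "?o \<oplus>\<^bsub>?Z\<^esub> ?f = (\<lambda>X\<in>carrier (HH1 K A). ?o X \<oplus> ?f X)"
      by (simp add: lie_cocycles1_def hom_space_def)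
    also have "\<dots> = restrict ?f (carrier (HH1 K A))"
      using Z.zero_closed
      by (intro restrict_ext)
        (auto simp: carrier_HH1 HH1_act_coset div_cocycle_coset Der_zero nakayama_div_closed)
    also have "\<dots> = ?f"
      by (simp add: div_cocycle_def)
    finally show ?thesis .
  qed
  then have "?f \<in> ?B +>\<^bsub>?Z\<^esub> ?f"
    using o by (force simp: a_r_coset_def')
  then have "?f \<in> ?B"
    using assms by (simp add: Div_class_def lie_H1_class_def lie_H1_def)
  then obtain z where z: "z \<in> carrier (center_alg A)" "?f = (\<lambda>X\<in>carrier (HH1 K A). HH1_act X z)"
    by (auto simp: lie_coboundaries1_def)
  have "nakayama_div K A form \<delta> = \<delta> z" if "\<delta> \<in> carrier (Der K A)" for \<delta>
    using fun_cong[OF z(2), of "InnDer A +>\<^bsub>Der K A\<^esub> \<delta>"] that z(1)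
    by (simp add: div_cocycle_coset HH1_act_coset carrier_HH1)
  then show ?thesis
    using that z(1) by blast
qed

end

subsection \<open>Trivial extensions\<close>

context assoc_algebra
begin

text \<open>In this context \<open>A\<close> is the base algebra, called \<open>B\<close> in the
  final theorem, and \<open>T\<close> is its trivial extension.\<close>

abbreviation T where "T \<equiv> trivial_extension K A"
abbreviation D where "D \<equiv> dual_space K A"

lemma dual_closed [simp]: "\<lbrakk>f \<in> carrier D; x \<in> carrier A\<rbrakk> \<Longrightarrow> f x \<in> carrier K"
  by (auto simp: dual_space_def carrier_hom_space)

lemma dual_add: "\<lbrakk>f \<in> carrier D; x \<in> carrier A; y \<in> carrier A\<rbrakk> \<Longrightarrow> f (x \<oplus> y) = f x \<oplus>\<^bsub>K\<^esub> f y"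
  by (auto simp: dual_space_def carrier_hom_space)

lemma dual_smult: "\<lbrakk>f \<in> carrier D; c \<in> carrier K; x \<in> carrier A\<rbrakk> \<Longrightarrow> f (c \<odot> x) = c \<otimes>\<^bsub>K\<^esub> f x"
  by (auto simp: dual_space_def carrier_hom_space)

lemma dual_zero: "f \<in> carrier D \<Longrightarrow> f \<zero> = \<zero>\<^bsub>K\<^esub>"
  using dual_smult[of f "\<zero>\<^bsub>K\<^esub>" \<zero>] by simp

lemma dualI:
  assumes "\<And>x. x \<in> carrier A \<Longrightarrow> f x \<in> carrier K"
    and "\<And>x y. \<lbrakk>x \<in> carrier A; y \<in> carrier A\<rbrakk> \<Longrightarrow> f (x \<oplus> y) = f x \<oplus>\<^bsub>K\<^esub> f y"
    and "\<And>c x. \<lbrakk>c \<in> carrier K; x \<in> carrier A\<rbrakk> \<Longrightarrow> f (c \<odot> x) = c \<otimes>\<^bsub>K\<^esub> f x"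
  shows "(\<lambda>x\<in>carrier A. f x) \<in> carrier D"
  using assms by (auto simp: dual_space_def carrier_hom_space)

lemma dual_eqI:
  "\<lbrakk>f \<in> carrier D; g \<in> carrier D; \<And>x. x \<in> carrier A \<Longrightarrow> f x = g x\<rbrakk> \<Longrightarrow> f = g"
  by (auto simp: dual_space_def carrier_hom_space intro: extensionalityI)

lemma dual_sel:
  "\<zero>\<^bsub>D\<^esub> = (\<lambda>b\<in>carrier A. \<zero>\<^bsub>K\<^esub>)"
  "f \<oplus>\<^bsub>D\<^esub> g = (\<lambda>b\<in>carrier A. f b \<oplus>\<^bsub>K\<^esub> g b)"
  "c \<odot>\<^bsub>D\<^esub> f = (\<lambda>b\<in>carrier A. c \<otimes>\<^bsub>K\<^esub> f b)"
  by (simp_all add: dual_space_def)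

lemma trivial_extension_sel:
  "carrier T = carrier A \<times> carrier D"
  "\<zero>\<^bsub>T\<^esub> = (\<zero>, \<lambda>b\<in>carrier A. \<zero>\<^bsub>K\<^esub>)"
  "\<one>\<^bsub>T\<^esub> = (\<one>, \<lambda>b\<in>carrier A. \<zero>\<^bsub>K\<^esub>)"
  "(x, f) \<oplus>\<^bsub>T\<^esub> (y, g) = (x \<oplus> y, \<lambda>b\<in>carrier A. f b \<oplus>\<^bsub>K\<^esub> g b)"
  "c \<odot>\<^bsub>T\<^esub> (x, f) = (c \<odot> x, \<lambda>b\<in>carrier A. c \<otimes>\<^bsub>K\<^esub> f b)"
  by (simp_all add: trivial_extension_def direct_sum_def dual_sel)

text \<open>With the units of the bimodule action removed, the left action of \<open>x\<close> sends
  \<open>g\<close> to \<open>b \<mapsto> g (b x)\<close>, and the right action of \<open>y\<close>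
  sends \<open>f\<close> to \<open>b \<mapsto> f (y b)\<close>.\<close>

lemma trivial_extension_mult:
  "\<lbrakk>x \<in> carrier A; y \<in> carrier A\<rbrakk> \<Longrightarrow>
    (x, f) \<otimes>\<^bsub>T\<^esub> (y, g) = (x \<otimes> y, \<lambda>b\<in>carrier A. g (b \<otimes> x) \<oplus>\<^bsub>K\<^esub> f (y \<otimes> b))"
  by (auto simp: trivial_extension_def direct_sum_def dual_sel dual_bimod_def intro!: restrict_ext)

lemma dual_mult_closed:
  assumes "x \<in> carrier A" "y \<in> carrier A" "f \<in> carrier D" "g \<in> carrier D"
  shows "(\<lambda>b\<in>carrier A. g (b \<otimes> x) \<oplus>\<^bsub>K\<^esub> f (y \<otimes> b)) \<in> carrier D"
  using assms
  by (intro dualI) (auto simp: l_distr r_distr dual_add dual_smult smult_mult_left smult_mult_right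
      R.r_distr R.a_ac)

text \<open>For associativity, both bracketings of \<open>(x, f) (y, g) (z, h)\<close> have the
  second component \<open>b \<mapsto> h (b x y) + g (z b x) + f (y z b)\<close>.\<close>

lemma trivial_extension_is_assoc_algebra: "assoc_algebra K T"
proof -
  have "module K (direct_sum A D)"
    by (rule direct_sum_is_module[OF module_axioms dual_space_is_module])
  then have M: "module K T"
    by (rule module_cong) (simp_all add: trivial_extension_def direct_sum_def)
  then interpret M: module K T .
  have V: "vectorspace K T"
    using M field_axioms by (simp add: vectorspace_def)
  have zero: "(\<lambda>b\<in>carrier A. \<zero>\<^bsub>K\<^esub>) \<in> carrier D"
    by (rule dualI) simp_all
  have R: "ring T"
  proof (rule ringI)
    show "abelian_group T" ..
    show "monoid T"
    proof (rule monoidI)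
      fix x y assume "x \<in> carrier T" "y \<in> carrier T"
      then show "x \<otimes>\<^bsub>T\<^esub> y \<in> carrier T"
        by (cases x; cases y) (auto simp: trivial_extension_sel trivial_extension_mult dual_mult_closed)
    next
      show "\<one>\<^bsub>T\<^esub> \<in> carrier T"
        using zero by (simp add: trivial_extension_sel)
    next
      fix x y z assume "x \<in> carrier T" "y \<in> carrier T" "z \<in> carrier T"
      then show "x \<otimes>\<^bsub>T\<^esub> y \<otimes>\<^bsub>T\<^esub> z = x \<otimes>\<^bsub>T\<^esub> (y \<otimes>\<^bsub>T\<^esub> z)"
        by (cases x; cases y; cases z)
          (auto simp: trivial_extension_sel trivial_extension_mult m_assoc R.a_assoc intro!: restrict_ext)
    next
      fix x assume "x \<in> carrier T"
      then show "\<one>\<^bsub>T\<^esub> \<otimes>\<^bsub>T\<^esub> x = x" "x \<otimes>\<^bsub>T\<^esub> \<one>\<^bsub>T\<^esub> = x"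
        by (cases x; auto simp: trivial_extension_sel trivial_extension_mult dual_mult_closed zero
            intro!: dual_eqI dualI simp: dual_add dual_smult)+
    qed
    fix x y z assume "x \<in> carrier T" "y \<in> carrier T" "z \<in> carrier T"
    then show "(x \<oplus>\<^bsub>T\<^esub> y) \<otimes>\<^bsub>T\<^esub> z = x \<otimes>\<^bsub>T\<^esub> z \<oplus>\<^bsub>T\<^esub> y \<otimes>\<^bsub>T\<^esub> z"
      "z \<otimes>\<^bsub>T\<^esub> (x \<oplus>\<^bsub>T\<^esub> y) = z \<otimes>\<^bsub>T\<^esub> x \<oplus>\<^bsub>T\<^esub> z \<otimes>\<^bsub>T\<^esub> y"
      by (cases x; cases y; cases z;
          auto simp: trivial_extension_sel trivial_extension_mult l_distr r_distr dual_add R.a_ac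
          intro!: restrict_ext)+
  qed
  show ?thesis
  proof (intro assoc_algebra.intro V R assoc_algebra_axioms.intro)
    fix c x y assume "c \<in> carrier K" "x \<in> carrier T" "y \<in> carrier T"
    then show "(c \<odot>\<^bsub>T\<^esub> x) \<otimes>\<^bsub>T\<^esub> y = c \<odot>\<^bsub>T\<^esub> (x \<otimes>\<^bsub>T\<^esub> y)"
      "x \<otimes>\<^bsub>T\<^esub> (c \<odot>\<^bsub>T\<^esub> y) = c \<odot>\<^bsub>T\<^esub> (x \<otimes>\<^bsub>T\<^esub> y)"
      by (cases x; cases y;
          auto simp: trivial_extension_sel trivial_extension_mult smult_mult_left smult_mult_right
          dual_smult R.r_distr intro!: restrict_ext)+
  qed
qed

text \<open>A functional on \<open>T\<close> is determined by its restrictions to \<open>A\<close>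
  and to \<open>D\<close>. The first is an element \<open>g\<close> of \<open>D\<close>, the second
  is evaluation at some \<open>x\<close> by reflexivity, and \<open>(x, g)\<close> represents the
  functional. Finite dimension enters through reflexivity and the separation of points.\<close>

lemma trivial_extension_is_symmetric_algebra:
  assumes "fin_dim"
  shows "symmetric_algebra K T (canonical_form K)"
proof -
  interpret T: assoc_algebra K T by (rule trivial_extension_is_assoc_algebra)
  let ?o = "\<lambda>b\<in>carrier A. \<zero>\<^bsub>K\<^esub>"
  have o: "?o \<in> carrier D"
    by (rule dualI) simp_all
  show ?thesis
  proof (intro symmetric_algebra.intro symmetric_algebra_axioms.intro T.assoc_algebra_axioms)
    fix b assume "b \<in> carrier T"
    then show "(\<lambda>a. canonical_form K a b) \<in> LinearCombinations.module_hom K T (self_module K)"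
      by (auto simp: module_hom_def trivial_extension_sel canonical_form_def dual_add dual_smult
          R.r_distr R.a_ac)
  next
    fix a b assume "a \<in> carrier T" "b \<in> carrier T"
    then show "canonical_form K a b = canonical_form K b a"
      by (auto simp: trivial_extension_sel canonical_form_def R.a_comm)
  next
    fix a b c assume "a \<in> carrier T" "b \<in> carrier T" "c \<in> carrier T"
    then show "canonical_form K (a \<otimes>\<^bsub>T\<^esub> b) c = canonical_form K a (b \<otimes>\<^bsub>T\<^esub> c)"
      by (auto simp: trivial_extension_sel trivial_extension_mult canonical_form_def R.a_ac)
  next
    fix \<phi> assume "\<phi> \<in> LinearCombinations.module_hom K T (self_module K)"
    then have \<phi>_closed: "\<And>a. a \<in> carrier T \<Longrightarrow> \<phi> a \<in> carrier K"
      and \<phi>_add: "\<And>a b. \<lbrakk>a \<in> carrier T; b \<in> carrier T\<rbrakk> \<Longrightarrow> \<phi> (a \<oplus>\<^bsub>T\<^esub> b) = \<phi> a \<oplus>\<^bsub>K\<^esub> \<phi> b"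
      and \<phi>_smult: "\<And>c a. \<lbrakk>c \<in> carrier K; a \<in> carrier T\<rbrakk> \<Longrightarrow> \<phi> (c \<odot>\<^bsub>T\<^esub> a) = c \<otimes>\<^bsub>K\<^esub> \<phi> a"
      by (auto simp: module_hom_def)
    have inl: "(x, ?o) \<in> carrier T" if "x \<in> carrier A" for x
      using that o by (simp add: trivial_extension_sel)
    have inr: "(\<zero>, f) \<in> carrier T" if "f \<in> carrier D" for f
      using that by (simp add: trivial_extension_sel)
    have "(\<lambda>f. \<phi> (\<zero>, f)) \<in> LinearCombinations.module_hom K D (self_module K)"
      using \<phi>_add[OF inr inr] \<phi>_smult[OF _ inr] \<phi>_closed[OF inr]
      by (auto simp: module_hom_def trivial_extension_sel dual_sel)
    then obtain x where x: "x \<in> carrier A" "\<And>f. f \<in> carrier D \<Longrightarrow> \<phi> (\<zero>, f) = f x"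
      using double_dual_surj[OF assms] by blast
    define g where "g = (\<lambda>y\<in>carrier A. \<phi> (y, ?o))"
    have g: "g \<in> carrier D"
      unfolding g_def using \<phi>_add[OF inl inl] \<phi>_smult[OF _ inl] \<phi>_closed[OF inl]
      by (intro dualI) (auto simp: trivial_extension_sel restrict_def cong: if_cong)
    have "\<phi> a = canonical_form K a (x, g)" if "a \<in> carrier T" for a
    proof -
      obtain y f where a: "a = (y, f)" "y \<in> carrier A" "f \<in> carrier D"
        using \<open>a \<in> carrier T\<close> by (auto simp: trivial_extension_sel)
      have "(\<lambda>b\<in>carrier A. ?o b \<oplus>\<^bsub>K\<^esub> f b) = f"
        using a(3) by (intro dual_eqI dualI) (auto simp: dual_add dual_smult)
      then have "a = (y, ?o) \<oplus>\<^bsub>T\<^esub> (\<zero>, f)"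
        using a by (simp add: trivial_extension_sel)
      then have "\<phi> a = g y \<oplus>\<^bsub>K\<^esub> f x"
        using a \<phi>_add[OF inl inr] x(2) by (simp add: g_def)
      then show ?thesis
        using a x g by (simp add: canonical_form_def R.a_comm)
    qed
    \<comment> \<open>Testing on the elements \<open>(\<zero>, f)\<close> determines the first
      component of \<open>d\<close>, testing on \<open>(b, 0)\<close> the second.\<close>
    moreover have "d = (x, g)"
      if d: "d \<in> carrier T" "\<And>a. a \<in> carrier T \<Longrightarrow> \<phi> a = canonical_form K a d" for d
    proof -
      obtain y h where yh: "d = (y, h)" "y \<in> carrier A" "h \<in> carrier D"
        using d(1) by (auto simp: trivial_extension_sel)
      have "y = x"
      proof (rule dual_separates_points[OF assms yh(2) x(1)])
        fix f assume f: "f \<in> carrier D"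
        then show "f y = f x"
          using d(2)[OF inr[OF f]] x(2) yh by (simp add: canonical_form_def dual_zero)
      qed
      moreover have "h = g"
      proof (rule dual_eqI[OF yh(3) g])
        fix b assume b: "b \<in> carrier A"
        then show "h b = g b"
          using d(2)[OF inl[OF b]] yh by (simp add: g_def canonical_form_def)
      qed
      ultimately show ?thesis
        using yh by simp
    qed
    moreover have "(x, g) \<in> carrier T"
      using x g by (simp add: trivial_extension_sel)
    ultimately show "\<exists>!d. d \<in> carrier T \<and> (\<forall>a\<in>carrier T. \<phi> a = canonical_form K a d)"
      by (intro ex1I[of _ "(x, g)"]) simp_all
  qed
qed

text \<open>The degree derivation of the grading of \<open>T\<close> with \<open>A\<close> in degree
  0 and \<open>D\<close> in degree 1.\<close>

definition euler
  where "euler = (\<lambda>a\<in>carrier T. (\<zero>, snd a))"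

text \<open>The Leibniz rule holds because the product respects the degree: the second component of
  a product is linear in the two second components, and the product of two elements of
  \<open>D\<close> is zero.\<close>

lemma euler_Der: "euler \<in> carrier (Der K T)"
proof -
  interpret T: assoc_algebra K T by (rule trivial_extension_is_assoc_algebra)
  show ?thesis
    unfolding euler_def
    by (rule T.DerI)
      (auto simp: trivial_extension_sel trivial_extension_mult dual_zero R.a_comm intro!: restrict_ext)
qed

text \<open>For \<open>c = (x, f)\<close>, pairing either \<open>euler c\<close> or \<open>c\<close>
  itself with the unit gives \<open>f \<one>\<close>.\<close>

lemma nakayama_div_euler:
  assumes "fin_dim"
  shows "nakayama_div K T (canonical_form K) euler = \<one>\<^bsub>T\<^esub>"
proof -
  interpret T: symmetric_algebra K T "canonical_form K"
    by (rule trivial_extension_is_symmetric_algebra[OF assms])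
  show ?thesis
    using euler_Der T.one_closed
    by (rule T.nakayama_div_eqI) (auto simp: euler_def trivial_extension_sel canonical_form_def)
qed

end

theorem lemma52:
  fixes K :: "('k, 'm) ring_scheme" and B :: "('k, 'b, 'n) module_scheme"
  assumes "assoc_algebra K B"
    and "vectorspace.fin_dim K B"
    and "carrier B \<noteq> {\<zero>\<^bsub>B\<^esub>}"
  defines "A \<equiv> trivial_extension K B"
  defines "H1 \<equiv> lie_H1 K (HH1 K A) (center_alg A) HH1_act"
  shows "Div_class K A (canonical_form K) \<in> carrier H1 \<and>
         Div_class K A (canonical_form K) \<noteq> \<zero>\<^bsub>H1\<^esub>"
proof -
  interpret B: assoc_algebra K B by fact
  interpret A: symmetric_algebra K A "canonical_form K"
    unfolding A_def by (rule B.trivial_extension_is_symmetric_algebra) fact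
  have "Div_class K A (canonical_form K) \<noteq> \<zero>\<^bsub>H1\<^esub>"
  proof
    assume "Div_class K A (canonical_form K) = \<zero>\<^bsub>H1\<^esub>"
    then obtain z where z: "z \<in> carrier (center_alg A)"
      "\<And>\<delta>. \<delta> \<in> carrier (Der K A) \<Longrightarrow> nakayama_div K A (canonical_form K) \<delta> = \<delta> z"
      using A.Div_class_eq_zeroD unfolding H1_def by blast
    have "\<one>\<^bsub>A\<^esub> = B.euler z"
      using z(2) B.euler_Der B.nakayama_div_euler[OF assms(2)] by (simp add: A_def)
    moreover have "z \<in> carrier A"
      using z(1) by (simp add: carrier_center)
    \<comment> \<open>Comparison of first components: the unit of \<open>A\<close> has the unit of
      \<open>B\<close> there, and every value of \<open>euler\<close> on the carrier has
      zero.\<close>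
    ultimately have "\<one>\<^bsub>B\<^esub> = \<zero>\<^bsub>B\<^esub>"
      by (simp add: A_def B.euler_def B.trivial_extension_sel)
    then show False
      using assms(3) B.one_zeroD by blast
  qed
  then show ?thesis
    using A.Div_class_in_H1 by (simp add: H1_def)
qed

end
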